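(* Let $m=m(n)$ with $m\to\infty$ and $\frac{m}{n}\to0$ as $n\to\infty$. Let $h = \sum_{i=0}^m h_i$ be the Hoeffding decomposition of $h = h(T_m(X_1,\ldots,X_m;P))$ (as a function of $X_1,\ldots,X_m$), and assume that $$|\mathfrak{d}_{ij}h| \le \frac{c_1}{m},\qquad |\mathfrak{d}_i(h-h_0-h_1)| \le c_2$$ for all $1\le i<j\le m$ and all $i=1,\ldots,m$, respectively, where $c_1$ and $c_2$ are absolute constants. Let $J_{m,1}(P)$ denote the first order Hoeffding term of $J_m(P)$ (as a function of $X_1,\ldots,X_n$). Then $$J_m(P) = \theta_m(P) + J_{m,1}(P) + \mathcal{O}_P\Big(\frac{m}{n}\Big).$$
   Context: $X_1,X_2,\ldots$ are i.i.d. random elements of $\mathbb{R}^p$ (or another separable metric space) with distribution $P$. $T_m=T_m(X_1,\ldots,X_m;P)$ is a sequence of symmetric statistics (symmetric in $X_1,\ldots,X_m$), which may depend on $P$, and $h$ is a bounded real (measurable) function defined on the range of $T_m$. One writes $h(X_{i_1},\ldots,X_{i_m};P)$ for $h(T_m(X_{i_1},\ldots,X_{i_m};P))$. Set $$\theta_m(P):=\mathbb{E}_P\,h(T_m(X_1,\ldots,X_m;P)),\qquad J_m(P)=J_{m,n}(P):=\frac{1}{\binom nm}\sum_{1\le i_1<\ldots<i_m\le n}h(T_m(X_{i_1},\ldots,X_{i_m};P)).$$ $Y_n=\mathcal{O}_P(a_n)$ means that $Y_n/a_n$ is stochastically bounded (tight) as $n\to\infty$. The constants $c_1,c_2$ do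 not depend on $m,n$. Difference operators: for a function $g(X_1,\ldots,X_N)$ of independent random variables, let $\bar X_1,\ldots,\bar X_N$ be independent copies of $X_1,\ldots,X_N$ (independent of them), let $T_ig$ be $g$ with $X_i$ replaced by $\bar X_i$, $T_{ij}=T_i\circ T_j$, and let $\bar{\mathbb{E}}_i$, $\bar{\mathbb{E}}_{ij}$ be expectation with respect to $\bar X_i$, respectively $\bar X_i,\bar X_j$. Then $\mathfrak{d}_ig=(\frac12\bar{\mathbb{E}}_i(g-T_ig)^2)^{1/2}$ and, for $i\ne j$, $\mathfrak{d}_{ij}g=(\frac14\bar{\mathbb{E}}_{ij}(g-T_ig-T_jg+T_{ij}g)^2)^{1/2}$. Hoeffding decomposition: a function $g(X_1,\ldots,X_N)\in L^1$ of independent random variables has a unique decomposition $g=g_0+g_1+\ldots+g_N$ with $g_0=\mathbb{E}g$ and $g_k=\sum_{i_1<\ldots<i_k}g_{i_1\ldots i_k}(X_{i_1},\ldots,X_{i_k})$ such that the integral of $g_{i_1\ldots i_k}$ with respect to the law of any one of its variables $X_{i_j}$ (the others fixed) vanishes. $g_1$ is the first order Hoeffding term. *)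

theory Defs
  imports "HOL-Probability.Probability"
begin

text \<open>
  A function of \<open>N\<close> variables is a function on the product \<open>\<Pi>\<^sub>E k\<in>{1..N}\<close>, so a tuple
  \<open>(x\<^sub>1, \<dots>, x\<^sub>N)\<close> is an extensional map \<open>x\<close> on \<open>{1..N}\<close>, and replacing the variable \<open>x\<^sub>i\<close> by
  an independent copy is \<open>x(i := y)\<close> with \<open>y\<close> distributed according to \<open>P\<close>.
\<close>

definition symmetric_fun :: "nat \<Rightarrow> 'a set \<Rightarrow> ((nat \<Rightarrow> 'a) \<Rightarrow> 'b) \<Rightarrow> bool" where
  "symmetric_fun N S g \<longleftrightarrow>
     (\<forall>\<pi>. \<pi> permutes {1..N} \<longrightarrow> (\<forall>x \<in> {1..N} \<rightarrow>\<^sub>E S. g (x \<circ> \<pi>) = g x))"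

definition diff1 :: "'a measure \<Rightarrow> nat \<Rightarrow> ((nat \<Rightarrow> 'a) \<Rightarrow> real) \<Rightarrow> (nat \<Rightarrow> 'a) \<Rightarrow> real" where
  "diff1 P i g x = sqrt (1/2 * (\<integral>y. (g x - g (x(i := y)))\<^sup>2 \<partial>P))"

definition diff2 :: "'a measure \<Rightarrow> nat \<Rightarrow> nat \<Rightarrow> ((nat \<Rightarrow> 'a) \<Rightarrow> real) \<Rightarrow> (nat \<Rightarrow> 'a) \<Rightarrow> real" where
  "diff2 P i j g x = sqrt (1/4 * (\<integral>(y, z). (g x - g (x(i := y)) - g (x(j := z))
       + g (x(i := y, j := z)))\<^sup>2 \<partial>(P \<Otimes>\<^sub>M P)))"

text \<open>
  A family \<open>G\<close> indexed by the subsets \<open>A = {i\<^sub>1 < \<dots> < i\<^sub>k}\<close> of \<open>{1..N}\<close> stands for the functions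
  \<open>g\<^bsub>i\<^sub>1 \<dots> i\<^sub>k\<^esub>\<close>; \<open>G A\<close> takes the tuple \<open>(x\<^sub>i)\<close>, \<open>i \<in> A\<close>, as its argument.
\<close>

definition hoeffding_term ::
    "nat \<Rightarrow> (nat set \<Rightarrow> (nat \<Rightarrow> 'a) \<Rightarrow> real) \<Rightarrow> nat \<Rightarrow> (nat \<Rightarrow> 'a) \<Rightarrow> real" where
  "hoeffding_term N G k x = (\<Sum>A | A \<subseteq> {1..N} \<and> card A = k. G A (restrict x A))"

text \<open>
  The decomposition is unique only up to null sets, so the identities are required almost
  everywhere. Integrability of the components is stated explicitly, since the Bochner integral
  of a non-integrable function is \<open>0\<close> by convention.
\<close>

definition hoeffding_decomposition ::
    "'a measure \<Rightarrow> nat \<Rightarrow> ((nat \<Rightarrow> 'a) \<Rightarrow> real) \<Rightarrow> (nat set \<Rightarrow> (nat \<Rightarrow> 'a) \<Rightarrow> real) \<Rightarrow> bool" where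
  "hoeffding_decomposition P N g G \<longleftrightarrow>
     (\<forall>A \<subseteq> {1..N}. integrable (\<Pi>\<^sub>M k\<in>A. P) (G A)) \<and>
     G {} (\<lambda>_. undefined) = (\<integral>x. g x \<partial>(\<Pi>\<^sub>M k\<in>{1..N}. P)) \<and>
     (\<forall>A \<subseteq> {1..N}. \<forall>i \<in> A.
        AE x in (\<Pi>\<^sub>M k\<in>A - {i}. P). (\<integral>y. G A (x(i := y)) \<partial>P) = 0) \<and>
     (AE x in (\<Pi>\<^sub>M k\<in>{1..N}. P). g x = (\<Sum>k=0..N. hoeffding_term N G k x))"

text \<open>
  The index set of the sum consists of the tuples \<open>1 \<le> i\<^sub>1 < \<dots> < i\<^sub>m \<le> n\<close>; for \<open>m > n\<close> it is empty
  and the value is \<open>0\<close>.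
\<close>

definition subsample_mean :: "nat \<Rightarrow> nat \<Rightarrow> ((nat \<Rightarrow> 'a) \<Rightarrow> real) \<Rightarrow> (nat \<Rightarrow> 'a) \<Rightarrow> real" where
  "subsample_mean m n g x = 1 / real (n choose m) *
     (\<Sum>i | i \<in> {1..m} \<rightarrow>\<^sub>E {1..n} \<and> strict_mono_on {1..m} i. g (\<lambda>k\<in>{1..m}. x (i k)))"

text \<open>
  The constant \<open>tight\<close> of the library bounds all members of the sequence; as every single real
  random variable is tight, this is the same as tightness for \<open>n \<rightarrow> \<infinity>\<close>.
\<close>

definition bigo_P :: "'w measure \<Rightarrow> (nat \<Rightarrow> 'w \<Rightarrow> real) \<Rightarrow> (nat \<Rightarrow> real) \<Rightarrow> bool" where
  "bigo_P M Y a \<longleftrightarrow> tight (\<lambda>n. distr M borel (\<lambda>\<omega>. Y n \<omega> / a n))"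

end

theory Submission
  imports Defs
begin

text \<open>
  Write \<open>R = J - E J - J\<^sub>1\<close> for the subsample mean \<open>J\<close> of a kernel \<open>g\<close> without its constant and
  first order terms. The idea is that \<open>R\<close> has second moment of order \<open>(m/n)\<^sup>2\<close>; dividing by
  \<open>m/n\<close> and applying Chebyshev's inequality then yields tightness.

  The second moment is controlled by differences of second order. With \<open>D\<^sub>i = I - E\<^sub>i\<close>, where
  \<open>E\<^sub>i\<close> integrates over the variable \<open>x\<^sub>i\<close>, every function \<open>F\<close> of independent variables
  satisfies \<open>E (F - E F - F\<^sub>1)\<^sup>2 \<le> \<Sum>\<^bsub>a<b\<^esub> E (D\<^sub>a D\<^sub>b F)\<^sup>2\<close> (\<open>second_order_Efron_Stein\<close>). In terms of the
  Hoeffding decomposition this says that a component of order \<open>k \<ge> 2\<close> is counted at least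
  once, namely \<open>k choose 2\<close> times, on the right. The proof adds one variable at a time and uses
  the classical Efron--Stein inequality on the fluctuation which the new variable brings.

  For the subsample mean, \<open>D\<^sub>a D\<^sub>b\<close> annihilates every summand that does not use both \<open>x\<^sub>a\<close> and
  \<open>x\<^sub>b\<close>. At most the fraction \<open>(m/n)\<^sup>2\<close> of the summands survives, and each of these is bounded by
  \<open>2 c\<^sub>1 / m\<close>, because \<open>D\<^sub>p D\<^sub>q g\<close> is the mean of an expression whose root mean square is twice
  \<open>diff2\<close>. Hence \<open>\<bar>D\<^sub>a D\<^sub>b J\<bar> \<le> 2 c\<^sub>1 m / n\<^sup>2\<close>, and summing the squares over fewer than \<open>n\<^sup>2\<close> pairs
  gives \<open>E R\<^sup>2 \<le> (2 c\<^sub>1 m / n)\<^sup>2\<close> (\<open>integral_nonlinear_part_subsample_mean_square_le\<close>).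

  Two matters remain. The first order term is taken from an arbitrary Hoeffding
  decomposition, so it has to be identified with the sum of the centred conditional means
  (\<open>nonlinear_part_hoeffding\<close>). And tightness concerns all members of the sequence, so the
  degenerate case \<open>m > n\<close> needs a bound too: there \<open>J = 0\<close>, the error is the constant
  \<open>- \<theta>\<close>, and \<open>m/n > 1\<close>, so boundedness of \<open>h\<close> suffices.
\<close>

section \<open>Bounded measurable functions\<close>

definition bounded_measurable :: "'a measure \<Rightarrow> ('a \<Rightarrow> real) \<Rightarrow> bool" where
  "bounded_measurable M f \<longleftrightarrow> f \<in> borel_measurable M \<and> (\<exists>B. \<forall>x\<in>space M. \<bar>f x\<bar> \<le> B)"

named_theorems bm_intros

lemma bounded_measurableI:
  "f \<in> borel_measurable M \<Longrightarrow> (\<And>x. x \<in> space M \<Longrightarrow> \<bar>f x\<bar> \<le> B) \<Longrightarrow> bounded_measurable M f"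
  by (auto simp: bounded_measurable_def)

lemma bounded_measurable_measurable: "bounded_measurable M f \<Longrightarrow> f \<in> borel_measurable M"
  by (simp add: bounded_measurable_def)

lemma bounded_measurable_const[bm_intros]: "bounded_measurable M (\<lambda>x. c)"
  by (auto simp: bounded_measurable_def)

lemma bounded_measurable_add[bm_intros]:
  assumes "bounded_measurable M f" "bounded_measurable M g"
  shows "bounded_measurable M (\<lambda>x. f x + g x)"
proof -
  obtain B C where "\<And>x. x \<in> space M \<Longrightarrow> \<bar>f x\<bar> \<le> B" "\<And>x. x \<in> space M \<Longrightarrow> \<bar>g x\<bar> \<le> C"
    using assms by (auto simp: bounded_measurable_def)
  then have "\<And>x. x \<in> space M \<Longrightarrow> \<bar>f x + g x\<bar> \<le> B + C"
    by (meson abs_triangle_ineq add_mono order_trans)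
  with assms show ?thesis
    by (intro bounded_measurableI[of _ _ "B + C"]) (auto simp: bounded_measurable_def)
qed

lemma bounded_measurable_mult[bm_intros]:
  assumes "bounded_measurable M f" "bounded_measurable M g"
  shows "bounded_measurable M (\<lambda>x. f x * g x)"
proof -
  obtain B C where "\<And>x. x \<in> space M \<Longrightarrow> \<bar>f x\<bar> \<le> B" "\<And>x. x \<in> space M \<Longrightarrow> \<bar>g x\<bar> \<le> C"
    using assms by (auto simp: bounded_measurable_def)
  then have "\<And>x. x \<in> space M \<Longrightarrow> \<bar>f x * g x\<bar> \<le> B * C"
    by (metis abs_ge_zero abs_mult mult_mono' )
  with assms show ?thesis
    by (intro bounded_measurableI[of _ _ "B * C"]) (auto simp: bounded_measurable_def)
qed

lemma bounded_measurable_diff[bm_intros]: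
  assumes "bounded_measurable M f" "bounded_measurable M g"
  shows "bounded_measurable M (\<lambda>x. f x - g x)"
  using bounded_measurable_add[OF assms(1)
      bounded_measurable_mult[OF bounded_measurable_const[of M "-1"] assms(2)]]
  by simp

lemma bounded_measurable_power2[bm_intros]:
  "bounded_measurable M f \<Longrightarrow> bounded_measurable M (\<lambda>x. (f x)\<^sup>2)"
  unfolding power2_eq_square by (rule bounded_measurable_mult)

lemma bounded_measurable_sum[bm_intros]:
  assumes "\<And>i. i \<in> S \<Longrightarrow> bounded_measurable M (f i)"
  shows "bounded_measurable M (\<lambda>x. \<Sum>i\<in>S. f i x)"
  using assms
  by (induction S rule: infinite_finite_induct) (auto intro!: bm_intros)

lemma bounded_measurable_compose:
  assumes "bounded_measurable N f" "g \<in> M \<rightarrow>\<^sub>M N"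
  shows "bounded_measurable M (\<lambda>x. f (g x))"
  using assms measurable_space[OF assms(2)]
  by (auto simp: bounded_measurable_def intro: measurable_compose)

lemma (in finite_measure) bounded_measurable_integrable:
  assumes "bounded_measurable M f"
  shows "integrable M f"
proof -
  obtain B where "\<And>x. x \<in> space M \<Longrightarrow> \<bar>f x\<bar> \<le> B"
    using assms by (auto simp: bounded_measurable_def)
  then show ?thesis
    using assms by (intro integrable_const_bound[of _ B]) (auto simp: bounded_measurable_def)
qed

lemma (in prob_space) integral_square_le:
  assumes "bounded_measurable M f"
  shows "(expectation f)\<^sup>2 \<le> expectation (\<lambda>x. (f x)\<^sup>2)"
  using variance_eq[of f] variance_positive[of f] assms
  by (simp add: bounded_measurable_integrable bounded_measurable_power2)

lemma bounded_measurable_section: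
  assumes "bounded_measurable (M \<Otimes>\<^sub>M N) (case_prod f)" "x \<in> space M"
  shows "bounded_measurable N (f x)"
  using bounded_measurable_compose[OF assms(1), of "Pair x" N] assms(2) by simp

lemma bounded_measurable_swap:
  assumes "bounded_measurable (M \<Otimes>\<^sub>M N) (case_prod f)"
  shows "bounded_measurable (N \<Otimes>\<^sub>M M) (\<lambda>(y, x). f x y)"
  using bounded_measurable_compose[OF assms measurable_pair_swap'] by (simp add: case_prod_unfold)

lemma bounded_measurable_integral:
  assumes N: "prob_space N" and f: "bounded_measurable (M \<Otimes>\<^sub>M N) (case_prod f)"
  shows "bounded_measurable M (\<lambda>x. \<integral>y. f x y \<partial>N)"
proof -
  interpret prob_space N by fact
  obtain B where B: "\<And>x. x \<in> space (M \<Otimes>\<^sub>M N) \<Longrightarrow> \<bar>case_prod f x\<bar> \<le> B"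
    using f unfolding bounded_measurable_def by blast
  show ?thesis
  proof (rule bounded_measurableI)
    show "(\<lambda>x. \<integral>y. f x y \<partial>N) \<in> borel_measurable M"
      using f by (intro borel_measurable_lebesgue_integral) (simp add: bounded_measurable_def)
    fix x assume x: "x \<in> space M"
    note fx = bounded_measurable_integrable[OF bounded_measurable_section[OF f x]]
    have bd: "\<bar>f x y\<bar> \<le> B" if "y \<in> space N" for y
      using B[of "(x, y)"] x that by (simp add: space_pair_measure)
    have "\<bar>\<integral>y. f x y \<partial>N\<bar> \<le> (\<integral>y. \<bar>f x y\<bar> \<partial>N)"
      by (rule integral_abs_bound)
    also have "\<dots> \<le> (\<integral>y. B \<partial>N)"
      using fx bd by (intro integral_mono) auto
    finally show "\<bar>\<integral>y. f x y \<partial>N\<bar> \<le> B"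
      by (simp add: prob_space)
  qed
qed

lemma bounded_measurable_Fubini:
  assumes M: "prob_space M" and N: "prob_space N"
    and f: "bounded_measurable (M \<Otimes>\<^sub>M N) (case_prod f)"
  shows "(\<integral>x. \<integral>y. f x y \<partial>N \<partial>M) = (\<integral>y. \<integral>x. f x y \<partial>M \<partial>N)"
proof -
  interpret M: prob_space M by fact
  interpret N: prob_space N by fact
  interpret pair_prob_space M N ..
  show ?thesis
    by (intro Fubini_integral[symmetric] P.bounded_measurable_integrable f)
qed

text \<open>
  Pythagoras for an orthogonal pair: \<open>u\<close> depends on the first variable only and \<open>v\<close> integrates to
  zero over the second one, so the cross term disappears in the inner integral. Both variance
  inequalities below are obtained by splitting off one coordinate in this way.
\<close>

lemma integral_square_add_fibrewise_centred:
  assumes M: "prob_space M" and N: "prob_space N"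
    and u: "bounded_measurable M u" and v: "bounded_measurable (M \<Otimes>\<^sub>M N) (case_prod v)"
    and centred: "\<And>x. x \<in> space M \<Longrightarrow> (\<integral>y. v x y \<partial>N) = 0"
  shows "(\<integral>x. \<integral>y. (u x + v x y)\<^sup>2 \<partial>N \<partial>M) = (\<integral>x. (u x)\<^sup>2 \<partial>M) + (\<integral>x. \<integral>y. (v x y)\<^sup>2 \<partial>N \<partial>M)"
proof -
  interpret M: prob_space M by fact
  interpret N: prob_space N by fact
  have "(\<integral>x. \<integral>y. (u x + v x y)\<^sup>2 \<partial>N \<partial>M) = (\<integral>x. (u x)\<^sup>2 + (\<integral>y. (v x y)\<^sup>2 \<partial>N) \<partial>M)"
  proof (rule Bochner_Integration.integral_cong[OF refl])
    fix x assume x: "x \<in> space M"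
    note vx = bounded_measurable_section[OF v x]
    have "(\<integral>y. (u x + v x y)\<^sup>2 \<partial>N) = (\<integral>y. (u x)\<^sup>2 + 2 * u x * v x y + (v x y)\<^sup>2 \<partial>N)"
      by (simp add: power2_sum algebra_simps)
    also have "\<dots> = (u x)\<^sup>2 + 2 * u x * (\<integral>y. v x y \<partial>N) + (\<integral>y. (v x y)\<^sup>2 \<partial>N)"
      using N.bounded_measurable_integrable[OF vx]
        N.bounded_measurable_integrable[OF bounded_measurable_power2[OF vx]]
      by (simp add: N.prob_space)
    finally show "(\<integral>y. (u x + v x y)\<^sup>2 \<partial>N) = (u x)\<^sup>2 + (\<integral>y. (v x y)\<^sup>2 \<partial>N)"
      by (simp add: centred[OF x])
  qed
  also have "\<dots> = (\<integral>x. (u x)\<^sup>2 \<partial>M) + (\<integral>x. \<integral>y. (v x y)\<^sup>2 \<partial>N \<partial>M)"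
  proof (rule Bochner_Integration.integral_add)
    show "integrable M (\<lambda>x. (u x)\<^sup>2)"
      by (intro M.bounded_measurable_integrable bm_intros u)
    have "bounded_measurable (M \<Otimes>\<^sub>M N) (\<lambda>(x, y). (v x y)\<^sup>2)"
      using bounded_measurable_power2[OF v] by (simp add: case_prod_unfold)
    then show "integrable M (\<lambda>x. \<integral>y. (v x y)\<^sup>2 \<partial>N)"
      by (intro M.bounded_measurable_integrable bounded_measurable_integral N)
  qed
  finally show ?thesis .
qed

section \<open>Centring in one coordinate and the Efron--Stein inequality\<close>

text \<open>
  \<open>average_out M i\<close> is the conditional expectation given all variables but \<open>x\<^sub>i\<close>, so that
  \<open>centre M i\<close> is the projection \<open>I - E\<^sub>i\<close>. Both are defined by a coordinate update: the same
  function then serves on the product over \<open>K\<close> and on the product over \<open>insert i K\<close>, which lets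
  inductions on the index set pass from one to the other without any change of carrier.
\<close>

definition average_out :: "('i \<Rightarrow> 'a measure) \<Rightarrow> 'i \<Rightarrow> (('i \<Rightarrow> 'a) \<Rightarrow> real) \<Rightarrow> ('i \<Rightarrow> 'a) \<Rightarrow> real" where
  "average_out M i F x = (\<integral>y. F (x(i := y)) \<partial>M i)"

definition centre :: "('i \<Rightarrow> 'a measure) \<Rightarrow> 'i \<Rightarrow> (('i \<Rightarrow> 'a) \<Rightarrow> real) \<Rightarrow> ('i \<Rightarrow> 'a) \<Rightarrow> real" where
  "centre M i F x = F x - average_out M i F x"

text \<open>
  \<open>conditional_mean M J F i y\<close> is \<open>E[F | x\<^sub>i = y]\<close>. The integral runs over all of \<open>J\<close>, including
  the coordinate \<open>i\<close> that the update overwrites; for probability measures this extra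
  integration has no effect.
\<close>

definition conditional_mean ::
    "('i \<Rightarrow> 'a measure) \<Rightarrow> 'i set \<Rightarrow> (('i \<Rightarrow> 'a) \<Rightarrow> real) \<Rightarrow> 'i \<Rightarrow> 'a \<Rightarrow> real" where
  "conditional_mean M J F i y = (\<integral>x. F (x(i := y)) \<partial>PiM J M)"

text \<open>
  The function minus its Hoeffding terms of orders zero and one, written with conditional means
  so that it makes sense without a chosen decomposition.
\<close>

definition nonlinear_part ::
    "('i \<Rightarrow> 'a measure) \<Rightarrow> 'i set \<Rightarrow> (('i \<Rightarrow> 'a) \<Rightarrow> real) \<Rightarrow> ('i \<Rightarrow> 'a) \<Rightarrow> real" where
  "nonlinear_part M J F x = F x - (\<integral>z. F z \<partial>PiM J M)
     - (\<Sum>i\<in>J. conditional_mean M J F i (x i) - (\<integral>z. F z \<partial>PiM J M))"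

lemma average_out_update [simp]: "average_out M i F (x(i := y)) = average_out M i F x"
  by (simp add: average_out_def)

lemma average_out_cong:
  assumes "\<And>x. x \<in> space (PiM (insert i K) M) \<Longrightarrow> F x = G x" "x \<in> space (PiM K M)"
  shows "average_out M i F x = average_out M i G x"
  unfolding average_out_def
proof (intro Bochner_Integration.integral_cong refl)
  fix y assume "y \<in> space (M i)"
  with assms(2) have "x(i := y) \<in> space (PiM (insert i K) M)"
    by (auto simp: space_PiM PiE_fun_upd)
  then show "F (x(i := y)) = G (x(i := y))" by (rule assms(1))
qed

lemma centre_cong:
  assumes "\<And>x. x \<in> space (PiM K M) \<Longrightarrow> F x = G x" "i \<in> K" "x \<in> space (PiM K M)"
  shows "centre M i F x = centre M i G x"
  using assms average_out_cong[of i K M F G x] by (simp add: centre_def insert_absorb)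

lemma bounded_measurable_update:
  assumes "bounded_measurable (PiM (insert i K) M) F"
  shows "bounded_measurable (PiM K M \<Otimes>\<^sub>M M i) (\<lambda>(x, y). F (x(i := y)))"
  using bounded_measurable_compose[OF assms measurable_add_dim] by (simp add: case_prod_unfold)

context product_prob_space
begin

lemma prob_space_PiM_all: "prob_space (PiM J M)"
  by (intro prob_space_PiM prob_space)

lemma integrable_PiM:
  "bounded_measurable (PiM J M) F \<Longrightarrow> integrable (PiM J M) F"
  using prob_space_PiM_all by (simp add: finite_measure.bounded_measurable_integrable prob_space_def)

lemma bounded_measurable_section_update:
  assumes "bounded_measurable (PiM (insert i K) M) F" "x \<in> space (PiM K M)"
  shows "bounded_measurable (M i) (\<lambda>y. F (x(i := y)))"
  using bounded_measurable_section[OF bounded_measurable_update[OF assms(1)] assms(2)] .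

lemma bounded_measurable_average_out:
  assumes "bounded_measurable (PiM (insert i K) M) F"
  shows "bounded_measurable (PiM K M) (average_out M i F)"
  using bounded_measurable_integral[OF prob_space bounded_measurable_update[OF assms]]
  by (simp add: average_out_def[abs_def])

lemma bounded_measurable_centre:
  assumes "bounded_measurable (PiM J M) F" "i \<in> J"
  shows "bounded_measurable (PiM J M) (centre M i F)"
  unfolding centre_def[abs_def]
  using assms bounded_measurable_average_out[of i J F] by (intro bm_intros) (auto simp: insert_absorb)

lemma integral_average_out:
  assumes "finite J" "i \<notin> J" "bounded_measurable (PiM (insert i J) M) F"
  shows "(\<integral>x. F x \<partial>PiM (insert i J) M) = (\<integral>x. average_out M i F x \<partial>PiM J M)"
  unfolding average_out_def using assms by (intro product_integral_insert integrable_PiM)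

lemma average_out_commute:
  assumes F: "bounded_measurable (PiM (insert i (insert j K)) M) F" and "i \<noteq> j"
    and x: "x \<in> space (PiM K M)"
  shows "average_out M i (average_out M j F) x = average_out M j (average_out M i F) x"
proof -
  have "(\<lambda>p. (x(i := fst p))(j := snd p)) \<in> M i \<Otimes>\<^sub>M M j \<rightarrow>\<^sub>M PiM (insert i (insert j K)) M"
    using x by (intro measurable_fun_upd[where J = "insert i K"] measurable_fun_upd[where J = K]) auto
  from bounded_measurable_compose[OF F this]
  have "bounded_measurable (M i \<Otimes>\<^sub>M M j) (\<lambda>(y, z). F (x(i := y, j := z)))"
    by (simp add: case_prod_unfold)
  from bounded_measurable_Fubini[OF prob_space prob_space this] show ?thesis
    using \<open>i \<noteq> j\<close> by (simp add: average_out_def fun_upd_twist)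
qed

lemma average_out_diff:
  assumes "bounded_measurable (PiM (insert i K) M) F" "bounded_measurable (PiM (insert i K) M) G"
    and "x \<in> space (PiM K M)"
  shows "average_out M i (\<lambda>x. F x - G x) x = average_out M i F x - average_out M i G x"
  unfolding average_out_def
  by (intro Bochner_Integration.integral_diff M.bounded_measurable_integrable
      bounded_measurable_section_update[OF _ assms(3)] assms)

text \<open>
  Projections in different coordinates commute, by Fubini. This is what allows the induction
  hypothesis for \<open>average_out M i F\<close> to be turned into a statement about \<open>F\<close>.
\<close>

lemma centre_average_out:
  assumes F: "bounded_measurable (PiM (insert i K) M) F" and j: "j \<in> K" "i \<noteq> j"
    and x: "x \<in> space (PiM K M)"
  shows "centre M j (average_out M i F) x = average_out M i (centre M j F) x"
proof -
  have ins: "insert j (insert i K) = insert i K" "insert j K = K" using j by auto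
  have centre_eq: "centre M j F = (\<lambda>x. F x - average_out M j F x)"
    by (simp add: fun_eq_iff centre_def)
  have "average_out M i (centre M j F) x
      = average_out M i F x - average_out M i (average_out M j F) x"
    unfolding centre_eq
    using F x ins by (intro average_out_diff bounded_measurable_average_out) auto
  also have "average_out M i (average_out M j F) x = average_out M j (average_out M i F) x"
    using F x ins j by (intro average_out_commute) (auto simp: insert_commute)
  finally show ?thesis by (simp add: centre_def[of M j "average_out M i F"])
qed

text \<open>
  Averaging contracts the second moment (Jensen).
\<close>

lemma integral_average_out_square_le:
  assumes J: "finite J" "i \<notin> J" and F: "bounded_measurable (PiM (insert i J) M) F"
  shows "(\<integral>x. (average_out M i F x)\<^sup>2 \<partial>PiM J M) \<le> (\<integral>x. (F x)\<^sup>2 \<partial>PiM (insert i J) M)"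
proof -
  have F2: "bounded_measurable (PiM (insert i J) M) (\<lambda>x. (F x)\<^sup>2)"
    by (intro bm_intros F)
  have "(\<integral>x. (average_out M i F x)\<^sup>2 \<partial>PiM J M) \<le> (\<integral>x. average_out M i (\<lambda>x. (F x)\<^sup>2) x \<partial>PiM J M)"
  proof (rule integral_mono)
    show "integrable (PiM J M) (\<lambda>x. (average_out M i F x)\<^sup>2)"
      "integrable (PiM J M) (average_out M i (\<lambda>x. (F x)\<^sup>2))"
      by (intro integrable_PiM bm_intros bounded_measurable_average_out F F2)+
    fix x assume "x \<in> space (PiM J M)"
    then show "(average_out M i F x)\<^sup>2 \<le> average_out M i (\<lambda>x. (F x)\<^sup>2) x"
      unfolding average_out_def
      by (intro M.integral_square_le bounded_measurable_section_update[OF F])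
  qed
  then show ?thesis
    using integral_average_out[OF J F2] by simp
qed

lemma integral_average_out_centre:
  assumes "bounded_measurable (PiM (insert i K) M) F" "x \<in> space (PiM K M)"
  shows "(\<integral>y. centre M i F (x(i := y)) \<partial>M i) = 0"
  using M.bounded_measurable_integrable[OF bounded_measurable_section_update[OF assms]]
  by (simp add: centre_def M.prob_space average_out_def)

lemma integral_empty_PiM: "(\<integral>z. F z \<partial>PiM {} M) = (F (\<lambda>_. undefined) :: real)"
proof -
  interpret E: prob_space "PiM {} M" by (rule prob_space_PiM_all)
  have "(\<integral>z. F z \<partial>PiM {} M) = (\<integral>z. F (\<lambda>_. undefined) \<partial>PiM {} M)"
    by (intro Bochner_Integration.integral_cong) (auto simp: space_PiM)
  then show ?thesis by (simp add: E.prob_space)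
qed

text \<open>
  Averaging out one coordinate \<open>i\<close> splits \<open>F - E F\<close> into \<open>centre M i F\<close> and the centred function
  \<open>average_out M i F\<close> of the other coordinates. These two are orthogonal, the first contributes
  the summand of \<open>i\<close>, and the second is covered by induction: centring it in \<open>j\<close> is the same as
  averaging \<open>centre M j F\<close>, which does not increase second moments.
\<close>

lemma Efron_Stein:
  assumes "finite J" "bounded_measurable (PiM J M) F"
  shows "(\<integral>x. (F x - (\<integral>z. F z \<partial>PiM J M))\<^sup>2 \<partial>PiM J M) \<le> (\<Sum>i\<in>J. \<integral>x. (centre M i F x)\<^sup>2 \<partial>PiM J M)"
  using assms
proof (induction J arbitrary: F rule: finite_induct)
  case empty
  then show ?case by (simp add: integral_empty_PiM)
next
  case (insert i J F)
  note F = insert.prems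
  let ?A = "average_out M i F" and ?m = "\<integral>z. F z \<partial>PiM (insert i J) M"
  have A: "bounded_measurable (PiM J M) ?A" by (rule bounded_measurable_average_out[OF F])
  have C: "bounded_measurable (PiM (insert i J) M) (centre M i F)"
    by (rule bounded_measurable_centre[OF F]) simp
  have m: "?m = (\<integral>z. ?A z \<partial>PiM J M)"
    by (rule integral_average_out[OF insert.hyps F])
  have "(\<integral>x. (F x - ?m)\<^sup>2 \<partial>PiM (insert i J) M)
      = (\<integral>x. average_out M i (\<lambda>x. (F x - ?m)\<^sup>2) x \<partial>PiM J M)"
    by (intro integral_average_out insert.hyps bm_intros F)
  also have "\<dots> = (\<integral>x. \<integral>y. ((?A x - ?m) + centre M i F (x(i := y)))\<^sup>2 \<partial>M i \<partial>PiM J M)"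
    by (simp add: average_out_def[of M i "\<lambda>x. (F x - ?m)\<^sup>2"] centre_def algebra_simps)
  also have "\<dots> = (\<integral>x. (?A x - ?m)\<^sup>2 \<partial>PiM J M) + (\<integral>x. \<integral>y. (centre M i F (x(i := y)))\<^sup>2 \<partial>M i \<partial>PiM J M)"
    by (intro integral_square_add_fibrewise_centred prob_space_PiM_all prob_space bm_intros A
        bounded_measurable_update C integral_average_out_centre[OF F])
  also have "(\<integral>x. \<integral>y. (centre M i F (x(i := y)))\<^sup>2 \<partial>M i \<partial>PiM J M)
      = (\<integral>x. (centre M i F x)\<^sup>2 \<partial>PiM (insert i J) M)"
    using integral_average_out[OF insert.hyps(1,2) bounded_measurable_power2[OF C]]
    by (simp add: average_out_def)
  also have "(\<integral>x. (?A x - ?m)\<^sup>2 \<partial>PiM J M) \<le> (\<Sum>j\<in>J. \<integral>x. (centre M j ?A x)\<^sup>2 \<partial>PiM J M)"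
    unfolding m by (rule insert.IH[OF A])
  also have "\<dots> \<le> (\<Sum>j\<in>J. \<integral>x. (centre M j F x)\<^sup>2 \<partial>PiM (insert i J) M)"
  proof (rule sum_mono)
    fix j assume j: "j \<in> J"
    then have "i \<noteq> j" using insert.hyps by auto
    have "(\<integral>x. (centre M j ?A x)\<^sup>2 \<partial>PiM J M) = (\<integral>x. (average_out M i (centre M j F) x)\<^sup>2 \<partial>PiM J M)"
      by (intro Bochner_Integration.integral_cong refl)
        (simp add: centre_average_out[OF F j \<open>i \<noteq> j\<close>])
    also have "\<dots> \<le> (\<integral>x. (centre M j F x)\<^sup>2 \<partial>PiM (insert i J) M)"
      using j by (intro integral_average_out_square_le insert.hyps bounded_measurable_centre F) simp
    finally show "(\<integral>x. (centre M j ?A x)\<^sup>2 \<partial>PiM J M)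
      \<le> (\<integral>x. (centre M j F x)\<^sup>2 \<partial>PiM (insert i J) M)" .
  qed
  finally show ?case
    using insert.hyps by simp
qed

end

section \<open>The second order Efron--Stein inequality\<close>

context product_prob_space
begin

text \<open>
  The second order difference \<open>(I - E\<^sub>i)(I - E\<^sub>j)F\<close> multiplied out. For \<open>i \<noteq> j\<close> it is the mean,
  over the two independent copies, of the expression whose mean square enters \<open>diff2\<close>.
\<close>

lemma centre_centre:
  assumes F: "bounded_measurable (PiM J M) F" and ij: "i \<in> J" "j \<in> J"
    and x: "x \<in> space (PiM J M)"
  shows "centre M i (centre M j F) x = F x - average_out M i F x - average_out M j F x
    + average_out M i (average_out M j F) x"
proof -
  have ins: "insert i J = J" "insert j J = J" using ij by auto
  have "average_out M i (centre M j F) x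
      = average_out M i F x - average_out M i (average_out M j F) x"
    unfolding centre_def[abs_def]
    using F x ins by (intro average_out_diff) (auto intro!: bounded_measurable_average_out)
  then show ?thesis by (simp add: centre_def)
qed

lemma conditional_mean_insert_new:
  assumes J: "finite J" "i \<notin> J" and F: "bounded_measurable (PiM (insert i J) M) F"
    and y: "y \<in> space (M i)"
  shows "conditional_mean M (insert i J) F i y = (\<integral>x. F (x(i := y)) \<partial>PiM J M)"
proof -
  have "(\<lambda>x. x(i := y)) \<in> PiM (insert i J) M \<rightarrow>\<^sub>M PiM (insert i J) M"
    using y by (intro measurable_fun_upd[where J = "insert i J"]) auto
  from bounded_measurable_compose[OF F this]
  have "conditional_mean M (insert i J) F i y = (\<integral>x. average_out M i (\<lambda>x. F (x(i := y))) x \<partial>PiM J M)"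
    unfolding conditional_mean_def by (intro integral_average_out J)
  then show ?thesis by (simp add: average_out_def M.prob_space)
qed

lemma conditional_mean_insert_old:
  assumes J: "finite J" "i \<notin> J" "j \<in> J" and F: "bounded_measurable (PiM (insert i J) M) F"
    and y: "y \<in> space (M j)"
  shows "conditional_mean M (insert i J) F j y = conditional_mean M J (average_out M i F) j y"
proof -
  have "i \<noteq> j" using J by auto
  have "(\<lambda>x. x(j := y)) \<in> PiM (insert i J) M \<rightarrow>\<^sub>M PiM (insert i J) M"
    using y J by (intro measurable_fun_upd[where J = "insert i J"]) auto
  from bounded_measurable_compose[OF F this]
  have "conditional_mean M (insert i J) F j y = (\<integral>x. average_out M i (\<lambda>x. F (x(j := y))) x \<partial>PiM J M)"
    unfolding conditional_mean_def by (intro integral_average_out J)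
  then show ?thesis
    using \<open>i \<noteq> j\<close> by (simp add: conditional_mean_def average_out_def fun_upd_twist)
qed

lemma bounded_measurable_conditional_mean:
  assumes "bounded_measurable (PiM J M) F" "i \<in> J"
  shows "bounded_measurable (M i) (conditional_mean M J F i)"
proof -
  have "bounded_measurable (PiM J M \<Otimes>\<^sub>M M i) (\<lambda>(x, y). F (x(i := y)))"
    using assms bounded_measurable_update[of i J M F] by (simp add: insert_absorb)
  from bounded_measurable_integral[OF prob_space_PiM_all bounded_measurable_swap[OF this]]
  show ?thesis by (simp add: conditional_mean_def[abs_def])
qed

lemma bounded_measurable_nonlinear_part:
  assumes "bounded_measurable (PiM J M) F"
  shows "bounded_measurable (PiM J M) (nonlinear_part M J F)"
  unfolding nonlinear_part_def[abs_def]
  by (intro bm_intros assms bounded_measurable_compose[OF bounded_measurable_conditional_mean] assms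
      measurable_component_singleton)

end

text \<open>
  When a coordinate \<open>i\<close> is added, the nonlinear part changes by the fluctuation, in the old
  coordinates, of the section of \<open>centre M i F\<close> at \<open>x\<^sub>i = y\<close>: the mean of that section is exactly
  the new first order term.
\<close>

lemma (in product_prob_space) nonlinear_part_insert:
  assumes J: "finite J" "i \<notin> J" and F: "bounded_measurable (PiM (insert i J) M) F"
    and x: "x \<in> space (PiM J M)" and y: "y \<in> space (M i)"
  shows "nonlinear_part M (insert i J) F (x(i := y)) = nonlinear_part M J (average_out M i F) x
    + (centre M i F (x(i := y)) - (\<integral>z. centre M i F (z(i := y)) \<partial>PiM J M))"
proof -
  let ?A = "average_out M i F"
  have xj: "x j \<in> space (M j)" "(x(i := y)) j = x j" if "j \<in> J" for j
    using that x J by (auto simp: space_PiM)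
  have "(\<Sum>j\<in>J. conditional_mean M (insert i J) F j ((x(i := y)) j) - (\<integral>z. ?A z \<partial>PiM J M))
      = (\<Sum>j\<in>J. conditional_mean M J ?A j (x j) - (\<integral>z. ?A z \<partial>PiM J M))"
    using xj by (intro sum.cong refl) (simp add: conditional_mean_insert_old[OF J _ F])
  moreover have "(\<integral>z. centre M i F (z(i := y)) \<partial>PiM J M)
      = conditional_mean M (insert i J) F i y - (\<integral>z. ?A z \<partial>PiM J M)"
  proof -
    have "bounded_measurable (PiM J M) (\<lambda>z. F (z(i := y)))"
      using bounded_measurable_section[OF bounded_measurable_swap[OF bounded_measurable_update[OF F]] y] .
    then show ?thesis
      unfolding conditional_mean_insert_new[OF J F y]
      using integrable_PiM[OF bounded_measurable_average_out[OF F]]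
      by (simp add: centre_def integrable_PiM)
  qed
  ultimately show ?thesis
    using J by (simp add: nonlinear_part_def integral_average_out[OF J F] centre_def)
qed

text \<open>
  The Efron--Stein inequality one order higher. In the decomposition of
  \<open>nonlinear_part_insert\<close> the two summands are orthogonal. The first is handled by
  induction. The second is, for each fixed value of the new coordinate \<open>i\<close>, a centred function of
  the old coordinates, so the Efron--Stein inequality bounds it by the differences
  \<open>centre M a (centre M i F)\<close> with \<open>a\<close> among the old coordinates. Adding the coordinates in
  increasing order counts every pair \<open>a < b\<close> once.
\<close>

lemma second_order_Efron_Stein:
  fixes M :: "'i :: linorder \<Rightarrow> 'a measure"
  assumes "\<And>i. prob_space (M i)" and "finite J" "bounded_measurable (PiM J M) F"
  shows "(\<integral>x. (nonlinear_part M J F x)\<^sup>2 \<partial>PiM J M)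
    \<le> (\<Sum>b\<in>J. \<Sum>a | a \<in> J \<and> a < b. \<integral>x. (centre M a (centre M b F) x)\<^sup>2 \<partial>PiM J M)"
  using assms(2,3)
proof (induction J arbitrary: F rule: finite_linorder_max_induct)
  case empty
  interpret product_prob_space M "{}"
    using assms(1) by (rule product_prob_spaceI)
  show ?case by (simp add: integral_empty_PiM nonlinear_part_def)
next
  case (insert i J F)
  interpret product_prob_space M J
    using assms(1) by (rule product_prob_spaceI)
  note F = insert.prems
  have J: "finite J" "i \<notin> J" using insert.hyps by auto
  let ?A = "average_out M i F" and ?G = "\<lambda>y x. centre M i F (x(i := y))"
  let ?v = "\<lambda>x y. ?G y x - (\<integral>z. ?G y z \<partial>PiM J M)"
  have A: "bounded_measurable (PiM J M) ?A" by (rule bounded_measurable_average_out[OF F])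
  have C: "bounded_measurable (PiM (insert i J) M) (centre M i F)"
    by (rule bounded_measurable_centre[OF F]) simp
  note G = bounded_measurable_update[OF C]
  note Gswap = bounded_measurable_swap[OF G]
  have EG: "bounded_measurable (M i) (\<lambda>y. \<integral>z. ?G y z \<partial>PiM J M)"
    by (rule bounded_measurable_integral[OF prob_space_PiM_all Gswap])
  have v: "bounded_measurable (PiM J M \<Otimes>\<^sub>M M i) (\<lambda>(x, y). ?v x y)"
    using bounded_measurable_diff[OF G bounded_measurable_compose[OF EG measurable_snd]]
    by (simp add: case_prod_unfold)
  have v2: "bounded_measurable (PiM J M \<Otimes>\<^sub>M M i) (\<lambda>(x, y). (?v x y)\<^sup>2)"
    using bounded_measurable_power2[OF v] by (simp add: case_prod_unfold)
  have CC: "bounded_measurable (PiM (insert i J) M) (\<lambda>x. (centre M a (centre M i F) x)\<^sup>2)"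
    if "a \<in> J" for a
    using that by (intro bm_intros bounded_measurable_centre[OF C]) simp
  note CCs = bounded_measurable_swap[OF bounded_measurable_update[OF CC]]
  have G_mean: "(\<integral>y. ?G y x \<partial>M i) = 0" if "x \<in> space (PiM J M)" for x
    by (rule integral_average_out_centre[OF F that])
  \<comment> \<open>Subtracting the mean of a section keeps the average over the new coordinate equal to zero.\<close>
  have v_mean: "(\<integral>y. ?v x y \<partial>M i) = 0" if x: "x \<in> space (PiM J M)" for x
  proof -
    have "(\<integral>y. \<integral>z. ?G y z \<partial>PiM J M \<partial>M i) = (\<integral>z. \<integral>y. ?G y z \<partial>M i \<partial>PiM J M)"
      by (rule bounded_measurable_Fubini[OF prob_space prob_space_PiM_all Gswap])
    also have "\<dots> = (\<integral>z. 0 \<partial>PiM J M)"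
      by (intro Bochner_Integration.integral_cong refl) (simp add: G_mean)
    finally show ?thesis
      using M.bounded_measurable_integrable[OF EG] G_mean[OF x]
        M.bounded_measurable_integrable[OF bounded_measurable_section_update[OF C x]]
      by simp
  qed
  \<comment> \<open>Integrate over the new coordinate first; the fibres then fall under the Pythagorean identity.\<close>
  have "(\<integral>x. (nonlinear_part M (insert i J) F x)\<^sup>2 \<partial>PiM (insert i J) M)
      = (\<integral>x. average_out M i (\<lambda>x. (nonlinear_part M (insert i J) F x)\<^sup>2) x \<partial>PiM J M)"
    by (intro integral_average_out J bm_intros bounded_measurable_nonlinear_part F)
  also have "\<dots> = (\<integral>x. \<integral>y. (nonlinear_part M J ?A x + ?v x y)\<^sup>2 \<partial>M i \<partial>PiM J M)"
    unfolding average_out_def[of M i "\<lambda>x. (nonlinear_part M (insert i J) F x)\<^sup>2"]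
    by (intro Bochner_Integration.integral_cong refl) (simp add: nonlinear_part_insert[OF J F])
  also have "\<dots> = (\<integral>x. (nonlinear_part M J ?A x)\<^sup>2 \<partial>PiM J M) + (\<integral>x. \<integral>y. (?v x y)\<^sup>2 \<partial>M i \<partial>PiM J M)"
    by (rule integral_square_add_fibrewise_centred[OF prob_space_PiM_all prob_space
        bounded_measurable_nonlinear_part[OF A] v v_mean])
  also have "(\<integral>x. (nonlinear_part M J ?A x)\<^sup>2 \<partial>PiM J M)
      \<le> (\<Sum>b\<in>J. \<Sum>a | a \<in> J \<and> a < b. \<integral>x. (centre M a (centre M b F) x)\<^sup>2 \<partial>PiM (insert i J) M)"
  proof (rule order_trans[OF insert.IH[OF A]], intro sum_mono)
    fix a b assume b: "b \<in> J" and "a \<in> {a. a \<in> J \<and> a < b}"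
    then have ab: "a \<in> J" "b \<in> J" "i \<noteq> a" "i \<noteq> b" using J by auto
    have Cb: "bounded_measurable (PiM (insert i J) M) (centre M b F)"
      using ab by (intro bounded_measurable_centre F) simp
    have "centre M a (centre M b ?A) x = average_out M i (centre M a (centre M b F)) x"
      if x: "x \<in> space (PiM J M)" for x
    proof -
      have "centre M a (centre M b ?A) x = centre M a (average_out M i (centre M b F)) x"
        by (rule centre_cong[OF centre_average_out[OF F ab(2,4)] ab(1) x])
      then show ?thesis by (simp add: centre_average_out[OF Cb ab(1,3) x])
    qed
    then have "(\<integral>x. (centre M a (centre M b ?A) x)\<^sup>2 \<partial>PiM J M)
        = (\<integral>x. (average_out M i (centre M a (centre M b F)) x)\<^sup>2 \<partial>PiM J M)"
      by (intro Bochner_Integration.integral_cong refl) simp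
    also have "\<dots> \<le> (\<integral>x. (centre M a (centre M b F) x)\<^sup>2 \<partial>PiM (insert i J) M)"
      using ab by (intro integral_average_out_square_le J bounded_measurable_centre[OF Cb]) simp
    finally show "(\<integral>x. (centre M a (centre M b ?A) x)\<^sup>2 \<partial>PiM J M)
      \<le> (\<integral>x. (centre M a (centre M b F) x)\<^sup>2 \<partial>PiM (insert i J) M)" .
  qed
  \<comment> \<open>Exchange the integrals, so that the new coordinate \<open>y\<close> is fixed in the inner one.\<close>
  also have "(\<integral>x. \<integral>y. (?v x y)\<^sup>2 \<partial>M i \<partial>PiM J M) = (\<integral>y. \<integral>x. (?v x y)\<^sup>2 \<partial>PiM J M \<partial>M i)"
    by (rule bounded_measurable_Fubini[OF prob_space_PiM_all prob_space v2])
  also have "\<dots> \<le> (\<integral>y. (\<Sum>a\<in>J. \<integral>x. (centre M a (centre M i F) (x(i := y)))\<^sup>2 \<partial>PiM J M) \<partial>M i)"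
  proof (rule integral_mono)
    show "integrable (M i) (\<lambda>y. \<integral>x. (?v x y)\<^sup>2 \<partial>PiM J M)"
      by (rule M.bounded_measurable_integrable[OF
          bounded_measurable_integral[OF prob_space_PiM_all bounded_measurable_swap[OF v2]]])
    show "integrable (M i) (\<lambda>y. \<Sum>a\<in>J. \<integral>x. (centre M a (centre M i F) (x(i := y)))\<^sup>2 \<partial>PiM J M)"
      by (intro Bochner_Integration.integrable_sum M.bounded_measurable_integrable
          bounded_measurable_integral[OF prob_space_PiM_all CCs])
    fix y assume y: "y \<in> space (M i)"
    have Gy: "bounded_measurable (PiM J M) (?G y)"
      by (rule bounded_measurable_section[OF Gswap y])
    have "centre M a (?G y) x = centre M a (centre M i F) (x(i := y))" if "a \<in> J" for a x
    proof -
      have "a \<noteq> i" using that J by auto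
      then show ?thesis
        by (simp add: centre_def[of M a] average_out_def[of M a] fun_upd_twist)
    qed
    with Efron_Stein[OF J(1) Gy]
    show "(\<integral>x. (?v x y)\<^sup>2 \<partial>PiM J M)
        \<le> (\<Sum>a\<in>J. \<integral>x. (centre M a (centre M i F) (x(i := y)))\<^sup>2 \<partial>PiM J M)"
      by simp
  qed
  also have "\<dots> = (\<Sum>a\<in>J. \<integral>x. (centre M a (centre M i F) x)\<^sup>2 \<partial>PiM (insert i J) M)"
  proof -
    have "(\<integral>y. (\<Sum>a\<in>J. \<integral>x. (centre M a (centre M i F) (x(i := y)))\<^sup>2 \<partial>PiM J M) \<partial>M i)
        = (\<Sum>a\<in>J. \<integral>y. \<integral>x. (centre M a (centre M i F) (x(i := y)))\<^sup>2 \<partial>PiM J M \<partial>M i)"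
      by (intro Bochner_Integration.integral_sum M.bounded_measurable_integrable
          bounded_measurable_integral[OF prob_space_PiM_all CCs])
    also have "\<dots> = (\<Sum>a\<in>J. \<integral>x. (centre M a (centre M i F) x)\<^sup>2 \<partial>PiM (insert i J) M)"
      using bounded_measurable_Fubini[OF prob_space prob_space_PiM_all CCs]
      by (intro sum.cong refl) (simp add: integral_average_out[OF J CC] average_out_def)
    finally show ?thesis .
  qed
  finally have "(\<integral>x. (nonlinear_part M (insert i J) F x)\<^sup>2 \<partial>PiM (insert i J) M) \<le>
      (\<Sum>b\<in>J. \<Sum>a | a \<in> J \<and> a < b. \<integral>x. (centre M a (centre M b F) x)\<^sup>2 \<partial>PiM (insert i J) M) +
      (\<Sum>a\<in>J. \<integral>x. (centre M a (centre M i F) x)\<^sup>2 \<partial>PiM (insert i J) M)"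
    by simp
  moreover have "{a. (a = i \<or> a \<in> J) \<and> a < i} = J"
    using insert.hyps by auto
  moreover have "{a. (a = i \<or> a \<in> J) \<and> a < b} = {a. a \<in> J \<and> a < b}" if "b \<in> J" for b
    using insert.hyps that by (auto dest: less_asym)
  ultimately show ?case
    using J by (simp add: add.commute)
qed

section \<open>Uniqueness of the first order Hoeffding term\<close>

context product_prob_space
begin

text \<open>
  Resampling a coordinate that belongs to the product leaves the law unchanged.
\<close>

lemma integral_average_out_same:
  assumes "finite J" "i \<in> J" "bounded_measurable (PiM J M) F"
  shows "(\<integral>x. average_out M i F x \<partial>PiM J M) = (\<integral>x. F x \<partial>PiM J M)"
proof -
  have J: "insert i (J - {i}) = J" "finite (J - {i})" "i \<notin> J - {i}"
    using assms by auto
  have avg: "bounded_measurable (PiM J M) (average_out M i F)"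
    using bounded_measurable_average_out[of i J F] assms by (simp add: insert_absorb)
  have "(\<integral>x. average_out M i F x \<partial>PiM J M)
      = (\<integral>x. average_out M i (average_out M i F) x \<partial>PiM (J - {i}) M)"
    using integral_average_out[OF J(2,3), of "average_out M i F", unfolded J(1)] avg by simp
  also have "average_out M i (average_out M i F) = average_out M i F"
    by (simp add: fun_eq_iff average_out_def[of M i "average_out M i F"] M.prob_space)
  also have "(\<integral>x. average_out M i F x \<partial>PiM (J - {i}) M) = (\<integral>x. F x \<partial>PiM J M)"
    using integral_average_out[OF J(2,3), of F, unfolded J(1)] assms by simp
  finally show ?thesis .
qed

lemma integral_component_PiM:
  fixes f :: "'a \<Rightarrow> real"
  assumes "i \<in> J" "f \<in> borel_measurable (M i)"
  shows "(\<integral>x. f (x i) \<partial>PiM J M) = (\<integral>y. f y \<partial>M i)"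
proof -
  interpret J: product_prob_space M J ..
  have "(\<integral>y. f y \<partial>M i) = (\<integral>y. f y \<partial>distr (PiM J M) (M i) (\<lambda>x. x i))"
    using J.PiM_component[OF assms(1)] by simp
  also have "\<dots> = (\<integral>x. f (x i) \<partial>PiM J M)"
    using assms by (intro integral_distr) auto
  finally show ?thesis ..
qed

lemma AE_component_PiM:
  assumes "i \<in> J" "AE y in M i. Q y"
  shows "AE x in PiM J M. Q (x i)"
proof -
  interpret J: product_prob_space M J ..
  have "AE y in distr (PiM J M) (M i) (\<lambda>x. x i). Q y"
    unfolding J.PiM_component[OF assms(1)] by (rule assms(2))
  then show ?thesis
    using assms(1) by (intro AE_distrD[where M' = "M i" and f = "\<lambda>x. x i"]) auto
qed

lemma integral_conditional_mean:
  assumes J: "finite J" "i \<in> J" and F: "bounded_measurable (PiM J M) F" and S: "S \<in> sets (M i)"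
  shows "(\<integral>x. F x * indicator S (x i) \<partial>PiM J M) = (\<integral>y. conditional_mean M J F i y * indicator S y \<partial>M i)"
proof -
  have ins: "insert i J = J" using J by auto
  have ind: "bounded_measurable (M i) (indicator S :: 'a \<Rightarrow> real)"
    using S by (intro bounded_measurableI[of _ _ 1]) (auto simp: indicator_def)
  have FS: "bounded_measurable (PiM J M) (\<lambda>x. F x * indicator S (x i))"
    using J by (intro bm_intros F bounded_measurable_compose[OF ind]) auto
  have "(\<integral>x. F x * indicator S (x i) \<partial>PiM J M)
      = (\<integral>x. average_out M i (\<lambda>x. F x * indicator S (x i)) x \<partial>PiM J M)"
    using integral_average_out_same[OF J FS] by simp
  also have "\<dots> = (\<integral>x. \<integral>y. F (x(i := y)) * indicator S y \<partial>M i \<partial>PiM J M)"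
    by (simp add: average_out_def)
  also have "\<dots> = (\<integral>y. \<integral>x. F (x(i := y)) * indicator S y \<partial>PiM J M \<partial>M i)"
    using bounded_measurable_update[of i J M "\<lambda>x. F x * indicator S (x i)"] FS
    by (intro bounded_measurable_Fubini prob_space_PiM_all prob_space) (simp add: ins)
  finally show ?thesis
    by (simp add: conditional_mean_def)
qed

lemma integrable_restrict_PiM:
  fixes G :: "_ \<Rightarrow> real"
  assumes "finite A" "A \<subseteq> J" "integrable (PiM A M) G"
  shows "integrable (PiM J M) (\<lambda>x. G (restrict x A))"
proof -
  interpret J: product_prob_space M J ..
  show ?thesis
    using assms J.distr_PiM_restrict_finite[OF assms(1,2)]
    by (intro integrable_distr[where M' = "PiM A M" and T = "\<lambda>x. restrict x A"])
      (auto intro: measurable_restrict_subset)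
qed

lemma integrable_restrict_PiM_indicator:
  fixes G :: "_ \<Rightarrow> real"
  assumes "finite A" "A \<subseteq> J" "integrable (PiM A M) G" "i \<in> J" "S \<in> sets (M i)"
  shows "integrable (PiM J M) (\<lambda>x. G (restrict x A) * indicator S (x i))"
proof -
  have "{x \<in> space (PiM J M). x i \<in> S} \<in> sets (PiM J M)"
    using assms by (intro sets_Collect_single)
  from integrable_real_mult_indicator[OF this integrable_restrict_PiM[OF assms(1-3)]]
  show ?thesis
    by (rule Bochner_Integration.integrable_cong[THEN iffD1, rotated 2])
      (auto simp: indicator_def)
qed

text \<open>
  A component of the Hoeffding decomposition is orthogonal to every function of a variable
  \<open>x\<^sub>i\<close> as soon as it involves another variable \<open>x\<^sub>j\<close>: integrating over \<open>x\<^sub>j\<close> first already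
  gives zero, for almost every choice of the remaining variables.
\<close>

lemma integral_degenerate_component_eq_0:
  fixes G :: "_ \<Rightarrow> real"
  assumes J: "finite J" "A \<subseteq> J" "j \<in> A" and G: "integrable (PiM A M) G"
    and deg: "AE x in PiM (A - {j}) M. (\<integral>y. G (x(j := y)) \<partial>M j) = 0"
    and i: "i \<in> J" "i \<noteq> j" and S: "S \<in> sets (M i)"
  shows "(\<integral>x. G (restrict x A) * indicator S (x i) \<partial>PiM J M) = 0"
proof -
  interpret Jj: product_prob_space M "J - {j}" ..
  have fin: "finite A" using J finite_subset by blast
  have ins: "insert j (J - {j}) = J" using J by auto
  have "AE x in PiM (J - {j}) M. (\<integral>y. G ((restrict x (A - {j}))(j := y)) \<partial>M j) = 0"
  proof (rule AE_distrD[where P = "\<lambda>x. (\<integral>y. G (x(j := y)) \<partial>M j) = 0"])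
    show "(\<lambda>x. restrict x (A - {j})) \<in> PiM (J - {j}) M \<rightarrow>\<^sub>M PiM (A - {j}) M"
      using J by (intro measurable_restrict_subset) auto
    have "distr (PiM (J - {j}) M) (PiM (A - {j}) M) (\<lambda>x. restrict x (A - {j})) = PiM (A - {j}) M"
      using J fin by (intro Jj.distr_PiM_restrict_finite) auto
    then show "AE x in distr (PiM (J - {j}) M) (PiM (A - {j}) M) (\<lambda>x. restrict x (A - {j})).
        (\<integral>y. G (x(j := y)) \<partial>M j) = 0"
      using deg by (simp only:)
  qed
  then have "AE x in PiM (J - {j}) M.
      (\<integral>y. G (restrict (x(j := y)) A) * indicator S ((x(j := y)) i) \<partial>M j) = 0"
  proof eventually_elim
    fix x assume x: "(\<integral>y. G ((restrict x (A - {j}))(j := y)) \<partial>M j) = 0"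
    have "(restrict x (A - {j}))(j := y) = restrict (x(j := y)) A" for y
      using J(3) by (auto simp: fun_eq_iff)
    with x show "(\<integral>y. G (restrict (x(j := y)) A) * indicator S ((x(j := y)) i) \<partial>M j) = 0"
      using i by simp
  qed
  then have "(\<integral>x. \<integral>y. G (restrict (x(j := y)) A) * indicator S ((x(j := y)) i) \<partial>M j \<partial>PiM (J - {j}) M) = 0"
    by (rule integral_eq_zero_AE)
  moreover have "(\<integral>x. G (restrict x A) * indicator S (x i) \<partial>PiM (insert j (J - {j})) M)
      = (\<integral>x. \<integral>y. G (restrict (x(j := y)) A) * indicator S ((x(j := y)) i) \<partial>M j \<partial>PiM (J - {j}) M)"
    using J i S fin G
    by (intro product_integral_insert integrable_restrict_PiM_indicator) auto
  ultimately show ?thesis unfolding ins by simp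
qed

end

lemma sum_hoeffding_term:
  "(\<Sum>k=0..n. hoeffding_term n G k x) = (\<Sum>A\<in>Pow {1..n}. G A (restrict x A))"
proof -
  have "(\<Sum>A\<in>Pow {1..n}. G A (restrict x A))
      = (\<Sum>k\<in>{0..n}. \<Sum>A\<in>{A \<in> Pow {1..n}. card A = k}. G A (restrict x A))"
    by (intro sum.group[symmetric]) (auto dest: card_mono[rotated])
  then show ?thesis by (simp add: hoeffding_term_def)
qed

lemma hoeffding_term_1:
  "hoeffding_term n G 1 x = (\<Sum>i\<in>{1..n}. G {i} (restrict x {i}))"
proof -
  have "{A. A \<subseteq> {1..n} \<and> card A = 1} = (\<lambda>i. {i}) ` {1..n}"
    by (auto simp: card_1_singleton_iff)
  then show ?thesis
    by (simp add: hoeffding_term_def sum.reindex)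
qed

text \<open>
  Uniqueness of the first order components. Both sides are tested against indicators of \<open>x\<^sub>i\<close>.
  On the decomposition of \<open>F\<close> every component except those of \<open>{}\<close> and \<open>{i}\<close> is killed, and the
  same test applied to \<open>F\<close> itself produces its conditional mean. Working with integrals against
  test functions avoids disintegrating the almost everywhere identities in the definition of
  the decomposition.
\<close>

lemma hoeffding_component_singleton_unique:
  assumes ps: "prob_space P"
    and F: "bounded_measurable (PiM {1..n} (\<lambda>_. P)) F"
    and K: "hoeffding_decomposition P n F K"
    and i: "i \<in> {1..n}"
  shows "AE y in P. K {i} (\<lambda>_\<in>{i}. y)
    = conditional_mean (\<lambda>_. P) {1..n} F i y - (\<integral>z. F z \<partial>PiM {1..n} (\<lambda>_. P))"
proof -
  let ?J = "{1..n}" and ?M = "\<lambda>_::nat. P"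
  let ?m = "\<integral>z. F z \<partial>PiM ?J ?M" and ?c = "conditional_mean ?M ?J F i"
  interpret base: prob_space P by (rule ps)
  interpret product_prob_space ?M ?J
    using ps by (intro product_prob_spaceI)
  have int: "integrable (PiM A ?M) (K A)" if "A \<subseteq> ?J" for A
    using K that by (simp add: hoeffding_decomposition_def)
  have K0: "K {} (\<lambda>_. undefined) = ?m"
    using K by (simp add: hoeffding_decomposition_def)
  have deg: "AE x in PiM (A - {j}) ?M. (\<integral>y. K A (x(j := y)) \<partial>P) = 0" if "A \<subseteq> ?J" "j \<in> A" for A j
    using K that by (simp add: hoeffding_decomposition_def)
  have AE_sum: "AE x in PiM ?J ?M. F x = (\<Sum>A\<in>Pow ?J. K A (restrict x A))"
    using K by (simp add: hoeffding_decomposition_def sum_hoeffding_term)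
  have c: "integrable P ?c"
    using bounded_measurable_conditional_mean[OF F i] by (rule base.bounded_measurable_integrable)
  have meas: "(\<lambda>y. \<lambda>_\<in>{i}. y) \<in> P \<rightarrow>\<^sub>M PiM {i} ?M"
    by (intro measurable_restrict) auto
  have Ki: "integrable P (\<lambda>y. K {i} (\<lambda>_\<in>{i}. y))"
  proof (rule integrable_distr[OF meas])
    show "integrable (distr P (PiM {i} ?M) (\<lambda>y. \<lambda>_\<in>{i}. y)) (K {i})"
      using distr_component[of i] int[of "{i}"] i by simp
  qed
  show ?thesis
  proof (rule density_unique_real)
    show "integrable P (\<lambda>y. K {i} (\<lambda>_\<in>{i}. y))" by fact
    show "integrable P (\<lambda>y. ?c y - ?m)" using c by simp
    fix S assume S: "S \<in> sets P"
    let ?ind = "\<lambda>x. indicator S (x i) :: real"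
    let ?I = "\<lambda>A. \<integral>x. K A (restrict x A) * ?ind x \<partial>PiM ?J ?M"
    have int': "integrable (PiM ?J ?M) (\<lambda>x. K A (restrict x A) * ?ind x)" if "A \<in> Pow ?J" for A
      using that i S int
      by (intro integrable_restrict_PiM_indicator) (auto intro: finite_subset)
    have "(\<integral>y. ?c y * indicator S y \<partial>P) = (\<integral>x. F x * ?ind x \<partial>PiM ?J ?M)"
      using integral_conditional_mean[OF _ i F S] by simp
    also have "\<dots> = (\<integral>x. (\<Sum>A\<in>Pow ?J. K A (restrict x A) * ?ind x) \<partial>PiM ?J ?M)"
    proof (rule integral_cong_AE)
      show "(\<lambda>x. F x * ?ind x) \<in> borel_measurable (PiM ?J ?M)"
        using bounded_measurable_measurable[OF F] i S by measurable
      show "(\<lambda>x. \<Sum>A\<in>Pow ?J. K A (restrict x A) * ?ind x) \<in> borel_measurable (PiM ?J ?M)"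
        using int' by (intro borel_measurable_sum borel_measurable_integrable)
      show "AE x in PiM ?J ?M. F x * ?ind x = (\<Sum>A\<in>Pow ?J. K A (restrict x A) * ?ind x)"
        using AE_sum by eventually_elim (simp add: sum_distrib_right)
    qed
    also have "\<dots> = (\<Sum>A\<in>Pow ?J. ?I A)"
      using int' by (intro Bochner_Integration.integral_sum)
    also have "\<dots> = (\<Sum>A\<in>{{}, {i}}. ?I A)"
    proof (rule sum.mono_neutral_right)
      show "\<forall>A\<in>Pow ?J - {{}, {i}}. ?I A = 0"
      proof
        fix A assume A: "A \<in> Pow ?J - {{}, {i}}"
        then obtain j where j: "j \<in> A" "j \<noteq> i" by auto
        show "?I A = 0"
          using A j i S by (intro integral_degenerate_component_eq_0[where j = j] int deg) auto
      qed
    qed (use i in auto)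
    also have "\<dots> = ?I {} + ?I {i}" by simp
    also have "?I {} = (\<integral>y. ?m * indicator S y \<partial>P)"
    proof -
      have "?I {} = (\<integral>x. ?m * ?ind x \<partial>PiM ?J ?M)"
        by (simp add: K0 restrict_def)
      also have "\<dots> = (\<integral>y. ?m * indicator S y \<partial>P)"
        using i S by (intro integral_component_PiM[where f = "\<lambda>y. ?m * indicator S y"]) auto
      finally show ?thesis .
    qed
    also have "?I {i} = (\<integral>y. K {i} (\<lambda>_\<in>{i}. y) * indicator S y \<partial>P)"
    proof -
      have "restrict x {i} = (\<lambda>_\<in>{i}. x i)" for x :: "nat \<Rightarrow> 'a" by auto
      then show ?thesis
        using integral_component_PiM[OF i, where f = "\<lambda>y. K {i} (\<lambda>_\<in>{i}. y) * indicator S y"]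
          Ki S by simp
    qed
    finally have "(\<integral>y. ?c y * indicator S y \<partial>P)
        = (\<integral>y. ?m * indicator S y \<partial>P) + (\<integral>y. K {i} (\<lambda>_\<in>{i}. y) * indicator S y \<partial>P)"
      by simp
    moreover have "(\<integral>y. (?c y - ?m) * indicator S y \<partial>P)
        = (\<integral>y. ?c y * indicator S y \<partial>P) - (\<integral>y. ?m * indicator S y \<partial>P)"
      using integrable_real_mult_indicator[OF S c] integrable_real_mult_indicator[OF S, of "\<lambda>_. ?m"]
      by (simp add: left_diff_distrib)
    ultimately show "(LINT y:S|P. K {i} (\<lambda>_\<in>{i}. y)) = (LINT y:S|P. ?c y - ?m)"
      by (simp add: set_lebesgue_integral_def mult.commute)
  qed
qed

lemma nonlinear_part_hoeffding:
  assumes ps: "prob_space P"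
    and F: "bounded_measurable (PiM {1..n} (\<lambda>_. P)) F"
    and K: "hoeffding_decomposition P n F K"
  shows "AE x in PiM {1..n} (\<lambda>_. P).
    F x - (\<integral>z. F z \<partial>PiM {1..n} (\<lambda>_. P)) - hoeffding_term n K 1 x = nonlinear_part (\<lambda>_. P) {1..n} F x"
proof -
  let ?J = "{1..n}" and ?M = "\<lambda>_::nat. P"
  interpret product_prob_space ?M ?J
    using ps by (intro product_prob_spaceI)
  have "AE x in PiM ?J ?M. \<forall>i\<in>?J. K {i} (\<lambda>_\<in>{i}. x i)
      = conditional_mean ?M ?J F i (x i) - (\<integral>z. F z \<partial>PiM ?J ?M)"
    by (intro AE_finite_allI AE_component_PiM hoeffding_component_singleton_unique[OF ps F K]) auto
  then show ?thesis
  proof eventually_elim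
    fix x assume x: "\<forall>i\<in>?J. K {i} (\<lambda>_\<in>{i}. x i)
      = conditional_mean ?M ?J F i (x i) - (\<integral>z. F z \<partial>PiM ?J ?M)"
    have "restrict x {i} = (\<lambda>_\<in>{i}. x i)" for i by auto
    with x show "F x - (\<integral>z. F z \<partial>PiM ?J ?M) - hoeffding_term n K 1 x = nonlinear_part ?M ?J F x"
      unfolding hoeffding_term_1 nonlinear_part_def by simp
  qed
qed

section \<open>Counting increasing tuples\<close>

text \<open>
  The index set of \<open>subsample_mean\<close> and the tuple selected by one of its elements.
\<close>

definition increasing_indices :: "nat \<Rightarrow> nat \<Rightarrow> (nat \<Rightarrow> nat) set" where
  "increasing_indices m n = {i \<in> {1..m} \<rightarrow>\<^sub>E {1..n}. strict_mono_on {1..m} i}"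

definition subtuple :: "nat \<Rightarrow> (nat \<Rightarrow> nat) \<Rightarrow> (nat \<Rightarrow> 'a) \<Rightarrow> nat \<Rightarrow> 'a" where
  "subtuple m i x = (\<lambda>k\<in>{1..m}. x (i k))"

lemma subsample_mean_eq:
  "subsample_mean m n g x = 1 / real (n choose m) * (\<Sum>i\<in>increasing_indices m n. g (subtuple m i x))"
  by (simp add: subsample_mean_def increasing_indices_def subtuple_def)

lemma increasing_indices_mem:
  assumes "i \<in> increasing_indices m n"
  shows "inj_on i {1..m}" "i \<in> {1..m} \<rightarrow> {1..n}" "strict_mono_on {1..m} i"
  using assms by (auto simp: increasing_indices_def intro: strict_mono_on_imp_inj_on)

lemma finite_increasing_indices: "finite (increasing_indices m n)"
  unfolding increasing_indices_def by (rule finite_subset[of _ "{1..m} \<rightarrow>\<^sub>E {1..n}"]) (auto intro: finite_PiE)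

text \<open>
  An increasing map is determined by its image, so the subsamples are counted by the
  subsets of size \<open>m\<close>.
\<close>

lemma bij_betw_image_increasing_indices:
  "bij_betw (\<lambda>i. i ` {1..m}) (increasing_indices m n) {B. B \<subseteq> {1..n} \<and> card B = m}"
proof (rule bij_betw_imageI)
  show "inj_on (\<lambda>i. i ` {1..m}) (increasing_indices m n)"
  proof (rule inj_onI)
    fix i j assume ij: "i \<in> increasing_indices m n" "j \<in> increasing_indices m n"
      and eq: "i ` {1..m} = j ` {1..m}"
    have sorted: "sorted_wrt (<) (map f [1..<Suc m])" if "f \<in> increasing_indices m n" for f
      unfolding sorted_wrt_map
    proof (rule sorted_wrt_mono_rel)
      show "sorted_wrt (<) [1..<Suc m]" by (rule sorted_wrt_upt)
      show "\<And>x y. x \<in> set [1..<Suc m] \<Longrightarrow> y \<in> set [1..<Suc m] \<Longrightarrow> x < y \<Longrightarrow> f x < f y"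
        using increasing_indices_mem(3)[OF that] by (auto intro: strict_mono_onD)
    qed
    have "set (map i [1..<Suc m]) = set (map j [1..<Suc m])"
      using eq by (simp add: atLeastLessThanSuc_atLeastAtMost del: upt_Suc)
    with sorted ij have "map i [1..<Suc m] = map j [1..<Suc m]"
      by (intro strict_sorted_equal) auto
    then have "i k = j k" if "k \<in> {1..m}" for k
      using that by (auto simp del: upt_Suc)
    then show "i = j"
      using ij by (intro PiE_ext[of _ "{1..m}" "\<lambda>_. {1..n}"]) (auto simp: increasing_indices_def)
  qed
  show "(\<lambda>i. i ` {1..m}) ` increasing_indices m n = {B. B \<subseteq> {1..n} \<and> card B = m}"
  proof (intro equalityI subsetI)
    fix B assume "B \<in> (\<lambda>i. i ` {1..m}) ` increasing_indices m n"
    then obtain i where i: "i \<in> increasing_indices m n" "B = i ` {1..m}" by blast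
    then show "B \<in> {B. B \<subseteq> {1..n} \<and> card B = m}"
      using increasing_indices_mem(1,2)[OF i(1)] by (auto simp: card_image)
  next
    fix B assume "B \<in> {B. B \<subseteq> {1..n} \<and> card B = m}"
    then have B: "B \<subseteq> {1..n}" "card B = m" "finite B" by (auto intro: finite_subset)
    obtain h where h: "bij_betw h {..<m} B" "strict_mono_on {..<m} h"
      using ex_bij_betw_strict_mono_card[OF B(3)] B(2) by blast
    define i where "i = (\<lambda>k\<in>{1..m}. h (k - 1))"
    have "(\<lambda>k. k - 1) ` {1..m} = {..<m}"
    proof (intro equalityI subsetI)
      fix k assume "k \<in> {..<m}"
      then show "k \<in> (\<lambda>k. k - 1) ` {1..m}" by (intro image_eqI[of _ _ "Suc k"]) auto
    qed auto
    then have im: "i ` {1..m} = B"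
      using h(1) by (simp add: i_def bij_betw_def image_image[symmetric] cong: image_cong_simp)
        (metis image_image)
    have "i \<in> increasing_indices m n"
      unfolding increasing_indices_def
    proof (intro CollectI conjI strict_mono_onI)
      show "i \<in> {1..m} \<rightarrow>\<^sub>E {1..n}"
        using im B(1) by (auto simp: i_def)
      fix r s assume "r \<in> {1..m}" "s \<in> {1..m}" "r < s"
      then show "i r < i s"
        by (auto simp: i_def intro!: strict_mono_onD[OF h(2)])
    qed
    with im show "B \<in> (\<lambda>i. i ` {1..m}) ` increasing_indices m n" by blast
  qed
qed

lemma card_increasing_indices: "card (increasing_indices m n) = n choose m"
  using bij_betw_same_card[OF bij_betw_image_increasing_indices[of m n]] n_subsets[of "{1..n}" m]
  by simp

text \<open>
  A fraction \<open>m(m-1) / (n(n-1))\<close> of the subsamples contains two given indices, and this is at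
  most \<open>(m/n)\<^sup>2\<close> because \<open>m \<le> n\<close>.
\<close>

lemma card_increasing_indices_through_pair:
  assumes ab: "a \<in> {1..n}" "b \<in> {1..n}" "a \<noteq> b" and "m \<le> n" "2 \<le> m"
  shows "real (card {i \<in> increasing_indices m n. a \<in> i ` {1..m} \<and> b \<in> i ` {1..m}})
    \<le> (real m / real n)\<^sup>2 * real (n choose m)"
proof -
  let ?I = "{i \<in> increasing_indices m n. a \<in> i ` {1..m} \<and> b \<in> i ` {1..m}}"
  let ?\<phi> = "\<lambda>i. i ` {1..m} - {a, b}"
  have img: "i ` {1..m} \<subseteq> {1..n}" "card (i ` {1..m}) = m" if "i \<in> increasing_indices m n" for i
    using bij_betw_apply[OF bij_betw_image_increasing_indices that] by auto
  have "card ?I \<le> card {B. B \<subseteq> {1..n} - {a, b} \<and> card B = m - 2}"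
  proof (rule card_inj_on_le)
    show "inj_on ?\<phi> ?I"
    proof (rule inj_onI)
      fix i j assume i: "i \<in> ?I" and j: "j \<in> ?I" and eq: "?\<phi> i = ?\<phi> j"
      have "i ` {1..m} = ?\<phi> i \<union> {a, b}"
        using i by auto
      also have "\<dots> = ?\<phi> j \<union> {a, b}"
        unfolding eq ..
      also have "\<dots> = j ` {1..m}"
        using j by auto
      finally show "i = j"
        using i j bij_betw_imp_inj_on[OF bij_betw_image_increasing_indices[of m n]]
        by (auto dest: inj_onD)
    qed
    show "?\<phi> ` ?I \<subseteq> {B. B \<subseteq> {1..n} - {a, b} \<and> card B = m - 2}"
    proof (intro subsetI, elim imageE)
      fix B i assume B: "B = ?\<phi> i" and i: "i \<in> ?I"
      have "card (?\<phi> i) = card (i ` {1..m}) - card {a, b}"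
        using i by (intro card_Diff_subset) auto
      then show "B \<in> {B. B \<subseteq> {1..n} - {a, b} \<and> card B = m - 2}"
        using B i img[of i] ab by auto
    qed
    show "finite {B. B \<subseteq> {1..n} - {a, b} \<and> card B = m - 2}"
      by (rule finite_subset[of _ "Pow {1..n}"]) auto
  qed
  also have "\<dots> = (n - 2) choose (m - 2)"
  proof -
    have "card ({1..n} - {a, b}) = n - 2"
      using ab by (subst card_Diff_subset) auto
    then show ?thesis by (subst n_subsets) auto
  qed
  finally have le: "card ?I \<le> (n - 2) choose (m - 2)" .
  define k where "k = m - 2"
  define l where "l = n - 2"
  have m: "m = Suc (Suc k)" and n: "n = Suc (Suc l)"
    using \<open>2 \<le> m\<close> \<open>m \<le> n\<close> by (simp_all add: k_def l_def)
  \<comment> \<open>Apply \<open>m (n choose m) = n (n-1 choose m-1)\<close> twice.\<close>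
  have absorb1: "m * (n choose m) = n * ((n - 1) choose (m - 1))"
    using binomial_absorption[of "Suc k" n] by (simp only: m diff_Suc_1)
  have absorb2: "(m - 1) * ((n - 1) choose (m - 1)) = (n - 1) * ((n - 2) choose (m - 2))"
    using binomial_absorption[of k "n - 1"]
    by (simp only: m n diff_Suc_1 diff_Suc_Suc numeral_2_eq_2 diff_0 minus_nat.diff_0)
  have "m * (m - 1) * (n choose m) = (m - 1) * (m * (n choose m))"
    by (simp only: ac_simps)
  also have "\<dots> = n * ((m - 1) * ((n - 1) choose (m - 1)))"
    unfolding absorb1 by (simp only: ac_simps)
  also have "\<dots> = n * (n - 1) * ((n - 2) choose (m - 2))"
    unfolding absorb2 by (simp only: ac_simps)
  finally have "m * (m - 1) * (n choose m) = n * (n - 1) * ((n - 2) choose (m - 2))" .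
  then have absorb: "real m * real (m - 1) * real (n choose m) = real n * real (n - 1) * real ((n - 2) choose (m - 2))"
    by (metis of_nat_mult)
  have pos: "real n * real (n - 1) \<noteq> 0"
    using n by simp
  have eq: "real ((n - 2) choose (m - 2))
      = (real m / real n) * (real (m - 1) / real (n - 1)) * real (n choose m)"
    unfolding times_divide_times_eq
    unfolding times_divide_eq_left absorb
    unfolding nonzero_mult_div_cancel_left[OF pos] ..
  have "real (m - 1) / real (n - 1) \<le> real m / real n"
    using \<open>m \<le> n\<close> by (simp add: m n field_simps)
  then have "(real m / real n) * (real (m - 1) / real (n - 1)) \<le> (real m / real n) * (real m / real n)"
    by (intro mult_left_mono) auto
  then have "real ((n - 2) choose (m - 2)) \<le> (real m / real n)\<^sup>2 * real (n choose m)"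
    unfolding eq power2_eq_square by (rule mult_right_mono) auto
  with of_nat_mono[OF le] show ?thesis
    by (rule order_trans)
qed

section \<open>Second differences of a subsample mean\<close>

lemma distr_subtuple:
  assumes "prob_space P" "i \<in> increasing_indices m n"
  shows "distr (PiM {1..n} (\<lambda>_. P)) (PiM {1..m} (\<lambda>_. P)) (subtuple m i) = PiM {1..m} (\<lambda>_. P)"
  using distr_PiM_reindex[of "{1..n}" "\<lambda>_. P" i "{1..m}"] assms increasing_indices_mem[OF assms(2)]
  by (simp add: subtuple_def[abs_def])

lemma measurable_subtuple:
  assumes "i \<in> increasing_indices m n"
  shows "subtuple m i \<in> PiM {1..n} (\<lambda>_. P) \<rightarrow>\<^sub>M PiM {1..m} (\<lambda>_. P)"
  unfolding subtuple_def[abs_def]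
  using increasing_indices_mem(2)[OF assms]
  by (intro measurable_restrict measurable_component_singleton) blast

lemma bounded_measurable_subtuple:
  assumes "bounded_measurable (PiM {1..m} (\<lambda>_. P)) g" "i \<in> increasing_indices m n"
  shows "bounded_measurable (PiM {1..n} (\<lambda>_. P)) (\<lambda>x. g (subtuple m i x))"
  by (rule bounded_measurable_compose[OF assms(1) measurable_subtuple[OF assms(2)]])

lemma bounded_measurable_subsample_mean:
  assumes "bounded_measurable (PiM {1..m} (\<lambda>_. P)) g"
  shows "bounded_measurable (PiM {1..n} (\<lambda>_. P)) (subsample_mean m n g)"
  unfolding subsample_mean_eq[abs_def]
  by (intro bm_intros bounded_measurable_subtuple assms)

lemma integral_subsample_mean:
  assumes P: "prob_space P" and g: "bounded_measurable (PiM {1..m} (\<lambda>_. P)) g" and "m \<le> n"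
  shows "(\<integral>x. subsample_mean m n g x \<partial>PiM {1..n} (\<lambda>_. P)) = (\<integral>x. g x \<partial>PiM {1..m} (\<lambda>_. P))"
proof -
  let ?L = "PiM {1..n} (\<lambda>_. P)" and ?\<theta> = "\<integral>x. g x \<partial>PiM {1..m} (\<lambda>_. P)"
  interpret L: prob_space ?L by (intro prob_space_PiM P)
  have eq: "(\<integral>x. g (subtuple m i x) \<partial>?L) = ?\<theta>" if i: "i \<in> increasing_indices m n" for i
    using integral_distr[OF measurable_subtuple[OF i] bounded_measurable_measurable[OF g]]
    unfolding distr_subtuple[OF P i] by simp
  have "(\<integral>x. subsample_mean m n g x \<partial>?L)
      = 1 / real (n choose m) * (\<integral>x. (\<Sum>i\<in>increasing_indices m n. g (subtuple m i x)) \<partial>?L)"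
    unfolding subsample_mean_eq by (rule integral_mult_right_zero)
  also have "(\<integral>x. (\<Sum>i\<in>increasing_indices m n. g (subtuple m i x)) \<partial>?L)
      = (\<Sum>i\<in>increasing_indices m n. \<integral>x. g (subtuple m i x) \<partial>?L)"
    by (intro Bochner_Integration.integral_sum L.bounded_measurable_integrable
        bounded_measurable_subtuple g)
  also have "\<dots> = (\<Sum>i\<in>increasing_indices m n. ?\<theta>)"
    by (intro sum.cong refl eq)
  also have "\<dots> = real (n choose m) * ?\<theta>"
    by (simp add: card_increasing_indices)
  finally show ?thesis
    using \<open>m \<le> n\<close> by simp
qed

lemma subtuple_update:
  assumes "i \<in> increasing_indices m n" "p \<in> {1..m}"
  shows "subtuple m i (x(i p := y)) = (subtuple m i x)(p := y)"
proof
  fix k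
  have "i k = i p \<longleftrightarrow> k = p" if "k \<in> {1..m}"
    using that assms(2) increasing_indices_mem(1)[OF assms(1)] by (rule inj_on_eq_iff[rotated])
  then show "subtuple m i (x(i p := y)) k = ((subtuple m i x)(p := y)) k"
    using assms(2) by (cases "k \<in> {1..m}") (auto simp: subtuple_def)
qed

lemma subtuple_update_other:
  assumes "a \<notin> i ` {1..m}"
  shows "subtuple m i (x(a := y)) = subtuple m i x"
proof
  fix k
  show "subtuple m i (x(a := y)) k = subtuple m i x k"
    using assms by (cases "k \<in> {1..m}") (auto simp: subtuple_def)
qed

text \<open>
  A difference in the coordinate \<open>i p\<close> of the large sample acts on the summand of the subsample
  \<open>i\<close> as the difference in its \<open>p\<close>-th argument.
\<close>

lemma centre_subtuple:
  assumes "i \<in> increasing_indices m n" "p \<in> {1..m}"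
  shows "centre (\<lambda>_. P) (i p) (\<lambda>x. g (subtuple m i x)) = (\<lambda>x. centre (\<lambda>_. P) p g (subtuple m i x))"
  by (rule ext) (simp only: centre_def average_out_def subtuple_update[OF assms])

lemma centre_subtuple_other:
  assumes "prob_space P" "a \<notin> i ` {1..m}"
  shows "centre (\<lambda>_. P) a (\<lambda>x. g (subtuple m i x)) = (\<lambda>x. 0)"
  by (rule ext) (simp add: centre_def average_out_def subtuple_update_other[OF assms(2)]
      prob_space.prob_space[OF assms(1)])

lemma centre_zero: "centre M i (\<lambda>x. 0) = (\<lambda>x. 0)"
  by (rule ext) (simp add: centre_def average_out_def)

lemma (in product_prob_space) centre_scaled_sum:
  assumes "\<And>s. s \<in> S \<Longrightarrow> bounded_measurable (PiM J M) (f s)" "i \<in> J" "x \<in> space (PiM J M)"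
  shows "centre M i (\<lambda>x. c * (\<Sum>s\<in>S. f s x)) x = c * (\<Sum>s\<in>S. centre M i (f s) x)"
proof -
  have ins: "insert i J = J" using assms(2) by auto
  have f: "integrable (M i) (\<lambda>y. f s (x(i := y)))" if "s \<in> S" for s
  proof (rule M.bounded_measurable_integrable)
    show "bounded_measurable (M i) (\<lambda>y. f s (x(i := y)))"
      using bounded_measurable_section_update[of i J "f s" x] assms(1)[OF that] assms(3)
      unfolding ins .
  qed
  have "average_out M i (\<lambda>x. c * (\<Sum>s\<in>S. f s x)) x = c * (\<integral>y. (\<Sum>s\<in>S. f s (x(i := y))) \<partial>M i)"
    unfolding average_out_def by (rule integral_mult_right_zero)
  also have "\<dots> = c * (\<Sum>s\<in>S. average_out M i (f s) x)"
    unfolding average_out_def using f by (subst Bochner_Integration.integral_sum) auto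
  finally have "average_out M i (\<lambda>x. c * (\<Sum>s\<in>S. f s x)) x = c * (\<Sum>s\<in>S. average_out M i (f s) x)" .
  then show ?thesis
    by (simp add: centre_def sum_subtractf right_diff_distrib)
qed

text \<open>
  The second difference is a mean over two independent copies, while \<open>diff2\<close> is half of the
  root mean square of the same expression; hence the factor 2.
\<close>

lemma abs_centre_centre_le_diff2:
  assumes ps: "prob_space P" and g: "bounded_measurable (PiM J (\<lambda>_. P)) g"
    and ij: "i \<in> J" "j \<in> J" "i \<noteq> j" and x: "x \<in> space (PiM J (\<lambda>_. P))"
  shows "\<bar>centre (\<lambda>_. P) i (centre (\<lambda>_. P) j g) x\<bar> \<le> 2 * diff2 P i j g x"
proof -
  interpret base: prob_space P by (rule ps)
  interpret pair_prob_space P P ..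
  interpret fam: product_prob_space "\<lambda>_. P" J using ps by (intro product_prob_spaceI)
  let ?\<psi> = "\<lambda>y z. g x - g (x(i := y)) - g (x(j := z)) + g (x(i := y, j := z))"
  have upd: "x(k := y) \<in> space (PiM J (\<lambda>_. P))" if "k \<in> J" "y \<in> space P" for k y
    using x that by (auto simp: space_PiM PiE_iff extensional_def)
  have sec: "bounded_measurable P (\<lambda>y. g (w(k := y)))" if "k \<in> J" "w \<in> space (PiM J (\<lambda>_. P))" for k w
    using fam.bounded_measurable_section_update[of k J g w] g that by (simp add: insert_absorb)
  have pairm: "bounded_measurable (P \<Otimes>\<^sub>M P) (\<lambda>p. g (x(i := fst p, j := snd p)))"
    using x ij
    by (intro bounded_measurable_compose[OF g] measurable_fun_upd[where J = J]
        measurable_fun_upd[where J = J]) auto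
  have \<psi>: "bounded_measurable (P \<Otimes>\<^sub>M P) (\<lambda>(y, z). ?\<psi> y z)"
    unfolding case_prod_unfold
    by (intro bm_intros pairm bounded_measurable_compose[OF sec[OF ij(1) x]]
        bounded_measurable_compose[OF sec[OF ij(2) x]]) auto
  have "(\<integral>p. (case p of (y, z) \<Rightarrow> ?\<psi> y z) \<partial>(P \<Otimes>\<^sub>M P)) = (\<integral>y. \<integral>z. ?\<psi> y z \<partial>P \<partial>P)"
    using integral_fst'[OF P.bounded_measurable_integrable[OF \<psi>]] by simp
  also have "\<dots> = (\<integral>y. g x - g (x(i := y)) - average_out (\<lambda>_. P) j g x + average_out (\<lambda>_. P) j g (x(i := y)) \<partial>P)"
    using sec[OF ij(2) x] sec[OF ij(2) upd[OF ij(1)]]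
    by (intro Bochner_Integration.integral_cong refl)
      (simp add: average_out_def base.bounded_measurable_integrable base.prob_space)
  also have "\<dots> = g x - average_out (\<lambda>_. P) i g x - average_out (\<lambda>_. P) j g x
      + average_out (\<lambda>_. P) i (average_out (\<lambda>_. P) j g) x"
  proof -
    have "bounded_measurable (PiM (insert i J) (\<lambda>_. P)) (average_out (\<lambda>_. P) j g)"
      using fam.bounded_measurable_average_out[of j J g] g ij by (simp add: insert_absorb)
    from fam.bounded_measurable_section_update[OF this x] sec[OF ij(1) x]
    show ?thesis
      by (simp add: average_out_def[of "\<lambda>_. P" i] base.bounded_measurable_integrable base.prob_space)
  qed
  also have "\<dots> = centre (\<lambda>_. P) i (centre (\<lambda>_. P) j g) x"
    by (rule fam.centre_centre[OF g ij(1,2) x, symmetric])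
  finally have "(centre (\<lambda>_. P) i (centre (\<lambda>_. P) j g) x)\<^sup>2
      \<le> (\<integral>p. (case p of (y, z) \<Rightarrow> ?\<psi> y z)\<^sup>2 \<partial>(P \<Otimes>\<^sub>M P))"
    using P.integral_square_le[OF \<psi>] by simp
  also have "(\<lambda>p. (case p of (y, z) \<Rightarrow> ?\<psi> y z)\<^sup>2) = (\<lambda>(y, z). (?\<psi> y z)\<^sup>2)"
    by (simp add: fun_eq_iff)
  finally have "\<bar>centre (\<lambda>_. P) i (centre (\<lambda>_. P) j g) x\<bar> \<le> sqrt (\<integral>(y, z). (?\<psi> y z)\<^sup>2 \<partial>(P \<Otimes>\<^sub>M P))"
    by (intro real_le_rsqrt) simp
  also have "\<dots> = 2 * diff2 P i j g x"
    by (simp add: diff2_def real_sqrt_mult real_sqrt_divide)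
  finally show ?thesis .
qed

text \<open>
  Differences are linear, and the second difference in \<open>a\<close> and \<open>b\<close> of a summand vanishes
  unless the subsample contains both indices. Averaging thus gains the fraction of
  subsamples that contain a given pair.
\<close>

lemma centre_centre_subsample_mean_bound:
  assumes ps: "prob_space P" and g: "bounded_measurable (PiM {1..m} (\<lambda>_. P)) g"
    and "m \<le> n" "0 \<le> c" and ab: "a \<in> {1..n}" "b \<in> {1..n}" "a < b"
    and bound: "\<And>p q. 1 \<le> p \<Longrightarrow> p < q \<Longrightarrow> q \<le> m \<Longrightarrow>
      AE x in PiM {1..m} (\<lambda>_. P). \<bar>centre (\<lambda>_. P) p (centre (\<lambda>_. P) q g) x\<bar> \<le> c"
  shows "AE x in PiM {1..n} (\<lambda>_. P).
    \<bar>centre (\<lambda>_. P) a (centre (\<lambda>_. P) b (subsample_mean m n g)) x\<bar> \<le> c * (real m / real n)\<^sup>2"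
proof -
  let ?M = "\<lambda>_::nat. P" and ?I = "increasing_indices m n"
  let ?L = "PiM {1..n} ?M" and ?D = "\<lambda>a b. \<lambda>f. centre (\<lambda>_::nat. P) a (centre (\<lambda>_::nat. P) b f)"
  let ?T = "{i \<in> ?I. a \<in> i ` {1..m} \<and> b \<in> i ` {1..m}}"
  interpret fam: product_prob_space ?M "{1..n}" using ps by (intro product_prob_spaceI)
  have gi: "bounded_measurable ?L (\<lambda>x. g (subtuple m i x))" if "i \<in> ?I" for i
    by (rule bounded_measurable_subtuple[OF g that])
  have linear: "?D a b (subsample_mean m n g) x
      = 1 / real (n choose m) * (\<Sum>i\<in>?I. ?D a b (\<lambda>x. g (subtuple m i x)) x)" if x: "x \<in> space ?L" for x
  proof -
    have "?D a b (subsample_mean m n g) x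
        = centre ?M a (\<lambda>x. 1 / real (n choose m) * (\<Sum>i\<in>?I. centre ?M b (\<lambda>x. g (subtuple m i x)) x)) x"
      unfolding subsample_mean_eq[abs_def]
      by (rule centre_cong[OF fam.centre_scaled_sum[OF gi ab(2)] ab(1) x])
    also have "\<dots> = 1 / real (n choose m) * (\<Sum>i\<in>?I. ?D a b (\<lambda>x. g (subtuple m i x)) x)"
      by (rule fam.centre_scaled_sum[OF fam.bounded_measurable_centre[OF gi ab(2)] ab(1) x])
    finally show ?thesis .
  qed
  have vanish: "?D a b (\<lambda>x. g (subtuple m i x)) x = 0" if i: "i \<in> ?I" and "i \<notin> ?T" for i x
  proof (cases "b \<in> i ` {1..m}")
    case True
    then obtain q where q: "b = i q" "q \<in> {1..m}" by blast
    have "a \<notin> i ` {1..m}" using that True by blast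
    then show ?thesis
      using centre_subtuple_other[OF ps] by (simp add: q centre_subtuple[OF i q(2)])
  next
    case False
    then show ?thesis by (simp add: centre_subtuple_other[OF ps False] centre_zero)
  qed
  have "AE x in ?L. \<forall>i\<in>?T. \<bar>?D a b (\<lambda>x. g (subtuple m i x)) x\<bar> \<le> c"
  proof (rule AE_finite_allI)
    show "finite ?T" using finite_increasing_indices by simp
    fix i assume "i \<in> ?T"
    then obtain p q where i: "i \<in> ?I" and p: "a = i p" "p \<in> {1..m}" and q: "b = i q" "q \<in> {1..m}"
      by blast
    \<comment> \<open>The bound is given for \<open>p < q\<close> only; the order is inherited since \<open>i\<close> is increasing.\<close>
    have "p < q"
    proof (rule ccontr)
      assume "\<not> p < q"
      then have "q < p \<or> q = p" by auto
      then have "i q \<le> i p"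
        using strict_mono_onD[OF increasing_indices_mem(3)[OF i] q(2) p(2)] by auto
      then show False using ab p q by simp
    qed
    have "AE x in distr ?L (PiM {1..m} ?M) (subtuple m i). \<bar>?D p q g x\<bar> \<le> c"
      unfolding distr_subtuple[OF ps i] using bound[of p q] p q \<open>p < q\<close> by auto
    then have "AE x in ?L. \<bar>?D p q g (subtuple m i x)\<bar> \<le> c"
      by (rule AE_distrD[OF measurable_subtuple[OF i]])
    then show "AE x in ?L. \<bar>?D a b (\<lambda>x. g (subtuple m i x)) x\<bar> \<le> c"
      unfolding p(1) q(1) centre_subtuple[OF i q(2)] centre_subtuple[OF i p(2)] .
  qed
  moreover have "AE x in ?L. x \<in> space ?L" by (rule AE_space)
  ultimately show ?thesis
  proof eventually_elim
    fix x assume le: "\<forall>i\<in>?T. \<bar>?D a b (\<lambda>x. g (subtuple m i x)) x\<bar> \<le> c" and x: "x \<in> space ?L"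
    have card: "real (card ?T) \<le> (real m / real n)\<^sup>2 * real (n choose m)"
    proof (cases "2 \<le> m")
      case True
      then show ?thesis
        using ab \<open>m \<le> n\<close> by (intro card_increasing_indices_through_pair) auto
    next
      case False
      then have "p = q" if "p \<in> {1..m}" "q \<in> {1..m}" for p q using that by auto
      then have "?T = {}" using ab by blast
      then show ?thesis unfolding \<open>?T = {}\<close> by simp
    qed
    have restrict: "(\<Sum>i\<in>?I. ?D a b (\<lambda>x. g (subtuple m i x)) x) = (\<Sum>i\<in>?T. ?D a b (\<lambda>x. g (subtuple m i x)) x)"
      by (rule sum.mono_neutral_right) (use finite_increasing_indices vanish in auto)
    have "\<bar>\<Sum>i\<in>?I. ?D a b (\<lambda>x. g (subtuple m i x)) x\<bar>
        \<le> (\<Sum>i\<in>?T. \<bar>?D a b (\<lambda>x. g (subtuple m i x)) x\<bar>)"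
      unfolding restrict by (rule sum_abs)
    also have "\<dots> \<le> real (card ?T) * c"
      by (rule sum_bounded_above) (rule bspec[OF le])
    also have "\<dots> \<le> ((real m / real n)\<^sup>2 * real (n choose m)) * c"
      by (rule mult_right_mono[OF card \<open>0 \<le> c\<close>])
    finally have "\<bar>\<Sum>i\<in>?I. ?D a b (\<lambda>x. g (subtuple m i x)) x\<bar>
      \<le> c * (real m / real n)\<^sup>2 * real (n choose m)" by (simp add: mult_ac)
    moreover have "0 < real (n choose m)" using \<open>m \<le> n\<close> by simp
    ultimately show "\<bar>?D a b (subsample_mean m n g) x\<bar> \<le> c * (real m / real n)\<^sup>2"
      unfolding linear[OF x] by (simp add: abs_mult divide_le_eq)
  qed
qed

text \<open>
  There are fewer than \<open>n\<^sup>2\<close> pairs, and the second difference of each is at most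
  \<open>(2c/m)(m/n)\<^sup>2 = 2cm/n\<^sup>2\<close>; so \<open>n\<^sup>2(2cm/n\<^sup>2)\<^sup>2 = (2cm/n)\<^sup>2\<close> bounds the second moment.
\<close>

lemma integral_nonlinear_part_subsample_mean_square_le:
  assumes ps: "prob_space P" and g: "bounded_measurable (PiM {1..m} (\<lambda>_. P)) g"
    and m: "1 \<le> m" "m \<le> n"
    and bound: "\<And>p q. 1 \<le> p \<Longrightarrow> p < q \<Longrightarrow> q \<le> m \<Longrightarrow>
      AE x in PiM {1..m} (\<lambda>_. P). \<bar>diff2 P p q g x\<bar> \<le> c / real m"
  shows "(\<integral>x. (nonlinear_part (\<lambda>_. P) {1..n} (subsample_mean m n g) x)\<^sup>2 \<partial>PiM {1..n} (\<lambda>_. P))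
    \<le> (2 * c * (real m / real n))\<^sup>2"
proof -
  let ?M = "\<lambda>_::nat. P" and ?F = "subsample_mean m n g"
  let ?L = "PiM {1..n} ?M" and ?D = "\<lambda>a b. \<lambda>f. centre (\<lambda>_::nat. P) a (centre (\<lambda>_::nat. P) b f)"
  interpret fam: product_prob_space ?M "{1..n}" using ps by (intro product_prob_spaceI)
  have F: "bounded_measurable ?L ?F" by (rule bounded_measurable_subsample_mean[OF g])
  define C where "C = 2 * \<bar>c\<bar> * real m / (real n)\<^sup>2"
  have small: "\<bar>?D a b ?F x\<bar> \<le> C \<Longrightarrow> (?D a b ?F x)\<^sup>2 \<le> C\<^sup>2" for a b x
    using power_mono[of "\<bar>?D a b ?F x\<bar>" C 2] by simp
  have "AE x in ?L. \<bar>?D a b ?F x\<bar> \<le> C" if ab: "a \<in> {1..n}" "b \<in> {1..n}" "a < b" for a b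
  proof -
    have "AE x in PiM {1..m} ?M. \<bar>?D p q g x\<bar> \<le> 2 * \<bar>c\<bar> / real m" if pq: "1 \<le> p" "p < q" "q \<le> m" for p q
      using bound[OF pq] AE_space
    proof eventually_elim
      fix x assume x: "x \<in> space (PiM {1..m} ?M)" and le: "\<bar>diff2 P p q g x\<bar> \<le> c / real m"
      have "\<bar>?D p q g x\<bar> \<le> 2 * diff2 P p q g x"
        using pq by (intro abs_centre_centre_le_diff2[OF ps g _ _ _ x]) auto
      also have "\<dots> \<le> 2 * (\<bar>c\<bar> / real m)"
        using le divide_right_mono[OF abs_ge_self[of c], of "real m"] by linarith
      finally show "\<bar>?D p q g x\<bar> \<le> 2 * \<bar>c\<bar> / real m" by simp
    qed
    from centre_centre_subsample_mean_bound[OF ps g m(2) _ ab this]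
    have "AE x in ?L. \<bar>?D a b ?F x\<bar> \<le> 2 * \<bar>c\<bar> / real m * (real m / real n)\<^sup>2" by simp
    also have "2 * \<bar>c\<bar> / real m * (real m / real n)\<^sup>2 = C"
      using m by (simp add: C_def power2_eq_square)
    finally show ?thesis .
  qed
  then have pair: "(\<integral>x. (?D a b ?F x)\<^sup>2 \<partial>?L) \<le> C\<^sup>2" if ab: "a \<in> {1..n}" "b \<in> {1..n}" "a < b" for a b
  proof -
    have "(\<integral>x. (?D a b ?F x)\<^sup>2 \<partial>?L) \<le> (\<integral>x. C\<^sup>2 \<partial>?L)"
    proof (rule integral_mono_AE)
      show "integrable ?L (\<lambda>x. (?D a b ?F x)\<^sup>2)"
        by (intro fam.integrable_PiM bm_intros fam.bounded_measurable_centre F ab)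
      show "AE x in ?L. (?D a b ?F x)\<^sup>2 \<le> C\<^sup>2"
        using \<open>\<And>b a. \<lbrakk>a \<in> {1..n}; b \<in> {1..n}; a < b\<rbrakk> \<Longrightarrow> AE x in ?L. \<bar>?D a b ?F x\<bar> \<le> C\<close>[OF ab]
        by eventually_elim (rule small)
      show "integrable ?L (\<lambda>x. C\<^sup>2)"
        by (intro fam.integrable_PiM bm_intros)
    qed
    then show ?thesis
      by (simp add: prob_space.prob_space[OF fam.prob_space_PiM_all])
  qed
  have "(\<integral>x. (nonlinear_part ?M {1..n} ?F x)\<^sup>2 \<partial>?L)
      \<le> (\<Sum>b\<in>{1..n}. \<Sum>a | a \<in> {1..n} \<and> a < b. \<integral>x. (?D a b ?F x)\<^sup>2 \<partial>?L)"
    using ps by (intro second_order_Efron_Stein F) auto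
  also have "\<dots> \<le> (\<Sum>b\<in>{1..n}. \<Sum>a | a \<in> {1..n} \<and> a < b. C\<^sup>2)"
    by (intro sum_mono pair) auto
  also have "\<dots> \<le> (\<Sum>b\<in>{1..n}. \<Sum>a\<in>{1..n}. C\<^sup>2)"
    by (intro sum_mono sum_mono2) auto
  also have "\<dots> = (real n * C)\<^sup>2"
    by (simp add: power2_eq_square)
  also have "real n * C = 2 * \<bar>c\<bar> * (real m / real n)"
    using m by (simp add: C_def power2_eq_square)
  finally show ?thesis by (simp only: power_mult_distrib power2_abs)
qed

section \<open>Tightness and the expansion of the subsample mean\<close>

text \<open>
  Chebyshev's inequality, uniformly along the sequence.
\<close>

lemma tight_if_bounded_second_moments:
  assumes ps: "prob_space M" and Z: "\<And>n. Z n \<in> borel_measurable M"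
    and int: "\<And>n. integrable M (\<lambda>\<omega>. (Z n \<omega>)\<^sup>2)"
    and bound: "\<And>n. (\<integral>\<omega>. (Z n \<omega>)\<^sup>2 \<partial>M) \<le> C"
  shows "tight (\<lambda>n. distr M borel (Z n :: _ \<Rightarrow> real))"
  unfolding tight_def
proof (intro conjI allI impI)
  interpret prob_space M by (rule ps)
  fix n
  show "real_distribution (distr M borel (Z n))"
    using Z by simp
next
  interpret prob_space M by (rule ps)
  fix \<epsilon> :: real assume \<epsilon>: "0 < \<epsilon>"
  have C: "0 \<le> C"
    using bound[of 0] by (rule order_trans[rotated]) simp
  \<comment> \<open>With \<open>C + 1\<close> instead of \<open>C\<close> the threshold stays positive for \<open>C = 0\<close>.\<close>
  define t where "t = sqrt (2 * (C + 1) / \<epsilon>)"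
  have t: "0 < t" "t\<^sup>2 = 2 * (C + 1) / \<epsilon>"
    using C \<epsilon> by (simp_all add: t_def)
  have "C / t\<^sup>2 < \<epsilon>"
    unfolding t(2) using C \<epsilon> by (simp add: field_simps add_nonneg_pos)
  show "\<exists>a b. a < b \<and> (\<forall>n. 1 - \<epsilon> < measure (distr M borel (Z n)) {a<..b})"
  proof (rule exI[of _ "-t"], rule exI[of _ t], intro conjI allI)
    fix n
    note [measurable] = Z
    let ?A = "{\<omega> \<in> space M. t \<le> \<bar>Z n \<omega>\<bar>}"
    have "prob ?A \<le> (\<integral>\<omega>. (Z n \<omega>)\<^sup>2 \<partial>M) / t\<^sup>2"
      using t by (intro second_moment_method Z int)
    also have "\<dots> \<le> C / t\<^sup>2"
      by (intro divide_right_mono bound) simp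
    finally have "1 - \<epsilon> < 1 - prob ?A" using \<open>C / t\<^sup>2 < \<epsilon>\<close> by linarith
    also have "\<dots> = prob (space M - ?A)"
      by (rule prob_compl[symmetric]) measurable
    also have "\<dots> \<le> prob (Z n -` {-t<..t} \<inter> space M)"
      by (intro finite_measure_mono) auto
    finally show "1 - \<epsilon> < measure (distr M borel (Z n)) {-t<..t}"
      by (simp add: measure_distr)
  qed (use t in simp)
qed

theorem proposition8p3:
  fixes M :: "'w measure"
    and X :: "nat \<Rightarrow> 'w \<Rightarrow> 'a :: {metric_space, second_countable_topology}"
    and P :: "'a measure"
    and N :: "'b measure"
    and T :: "nat \<Rightarrow> (nat \<Rightarrow> 'a) \<Rightarrow> 'a measure \<Rightarrow> 'b"
    and h :: "'b \<Rightarrow> real"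
    and m :: "nat \<Rightarrow> nat"
    and H K :: "nat \<Rightarrow> nat set \<Rightarrow> (nat \<Rightarrow> 'a) \<Rightarrow> real"
    and c\<^sub>1 c\<^sub>2 :: real
  defines "g \<equiv> \<lambda>k x. h (T k x P)"
  defines "\<theta> \<equiv> \<lambda>k. \<integral>x. g k x \<partial>(\<Pi>\<^sub>M i\<in>{1..k}. P)"
  defines "J \<equiv> \<lambda>n. subsample_mean (m n) n (g (m n))"
  assumes "prob_space M"
    and "prob_space.indep_vars M (\<lambda>_. borel) X {1..}"
    and "\<And>i. i \<ge> 1 \<Longrightarrow> distr M borel (X i) = P"
    and "\<And>k. (\<lambda>x. T k x P) \<in> (\<Pi>\<^sub>M i\<in>{1..k}. P) \<rightarrow>\<^sub>M N"
    and "\<And>k. symmetric_fun k UNIV (\<lambda>x. T k x P)"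
    and "h \<in> borel_measurable N"
    and "bounded (h ` space N)"
    and "filterlim m at_top sequentially"
    and "(\<lambda>n. real (m n) / real n) \<longlonglongrightarrow> 0"
    and "\<And>n. hoeffding_decomposition P (m n) (g (m n)) (H n)"
    and "\<And>n i j. 1 \<le> i \<Longrightarrow> i < j \<Longrightarrow> j \<le> m n \<Longrightarrow>
           AE x in (\<Pi>\<^sub>M k\<in>{1..m n}. P). \<bar>diff2 P i j (g (m n)) x\<bar> \<le> c\<^sub>1 / real (m n)"
    and "\<And>n i. 1 \<le> i \<Longrightarrow> i \<le> m n \<Longrightarrow>
           AE x in (\<Pi>\<^sub>M k\<in>{1..m n}. P).
             \<bar>diff1 P i (\<lambda>x. g (m n) x - hoeffding_term (m n) (H n) 0 x
                                     - hoeffding_term (m n) (H n) 1 x) x\<bar> \<le> c\<^sub>2"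
    and "\<And>n. hoeffding_decomposition P n (J n) (K n)"
  shows "bigo_P M
           (\<lambda>n \<omega>. let x = (\<lambda>k\<in>{1..n}. X k \<omega>)
                  in J n x - (\<theta> (m n) + hoeffding_term n (K n) 1 x))
           (\<lambda>n. real (m n) / real n)"
proof -
  interpret M: prob_space M by fact
  have indep: "M.indep_vars (\<lambda>_. borel) X {1..}"
    and distr_X: "\<And>i. i \<ge> 1 \<Longrightarrow> distr M borel (X i) = P"
    and T: "\<And>k. (\<lambda>x. T k x P) \<in> (\<Pi>\<^sub>M i\<in>{1..k}. P) \<rightarrow>\<^sub>M N"
    and h: "h \<in> borel_measurable N"
    and diff2_le: "\<And>n i j. 1 \<le> i \<Longrightarrow> i < j \<Longrightarrow> j \<le> m n \<Longrightarrow>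
           AE x in (\<Pi>\<^sub>M k\<in>{1..m n}. P). \<bar>diff2 P i j (g (m n)) x\<bar> \<le> c\<^sub>1 / real (m n)"
    and K: "\<And>n. hoeffding_decomposition P n (J n) (K n)"
    by fact+
  have X: "X i \<in> borel_measurable M" if "i \<ge> 1" for i
    using indep that by (auto simp: M.indep_vars_def)
  have ps: "prob_space P"
    using M.prob_space_distr[OF X[of 1]] distr_X[of 1] by simp
  have sets_P: "sets P = sets borel"
    using distr_X[of 1] by (metis order_refl sets_distr)
  obtain B where B: "\<And>y. y \<in> space N \<Longrightarrow> \<bar>h y\<bar> \<le> B"
    using \<open>bounded (h ` space N)\<close> by (auto simp: bounded_iff)
  define L where "L n = PiM {1..n} (\<lambda>_. P)" for n :: nat
  have prob_L: "prob_space (L n)" for n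
    unfolding L_def by (intro prob_space_PiM ps)
  have g_bound: "\<bar>g k x\<bar> \<le> B" if "x \<in> space (L k)" for k x
    unfolding g_def using that measurable_space[OF T] by (intro B) (simp add: L_def)
  have g: "bounded_measurable (L k) (g k)" for k
  proof (rule bounded_measurableI[OF _ g_bound])
    show "g k \<in> borel_measurable (L k)"
      unfolding g_def L_def using measurable_compose[OF T h] .
  qed
  have J: "bounded_measurable (L n) (J n)" for n
    unfolding J_def L_def by (rule bounded_measurable_subsample_mean[OF g[unfolded L_def]])
  have \<theta>_bound: "\<bar>\<theta> k\<bar> \<le> B" for k
  proof -
    interpret L: prob_space "L k" by (rule prob_L)
    have "\<bar>\<theta> k\<bar> \<le> (\<integral>x. \<bar>g k x\<bar> \<partial>L k)"
      unfolding \<theta>_def L_def by (rule integral_abs_bound)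
    also have "\<dots> \<le> (\<integral>x. B \<partial>L k)"
      using L.bounded_measurable_integrable[OF g] g_bound by (intro integral_mono) auto
    finally show ?thesis by (simp add: L.prob_space)
  qed
  define \<phi> where "\<phi> n \<omega> = (\<lambda>k\<in>{1..n}. X k \<omega>)" for n \<omega>
  have \<phi>: "\<phi> n \<in> M \<rightarrow>\<^sub>M L n" for n
    unfolding \<phi>_def[abs_def] L_def
    using X by (intro measurable_restrict) (auto simp: measurable_cong_sets[OF refl sets_P])
  have distr_\<phi>: "distr M (L n) (\<phi> n) = L n" if "n \<ge> 1" for n
  proof -
    have "M.indep_vars (\<lambda>_. borel) X {1..n}"
      by (rule M.indep_vars_subset[OF indep]) auto
    then have "distr M (PiM {1..n} (\<lambda>_. borel)) (\<phi> n) = PiM {1..n} (\<lambda>i. distr M borel (X i))"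
      unfolding \<phi>_def[abs_def] using that X
      by (subst (asm) M.indep_vars_iff_distr_eq_PiM') auto
    also have "PiM {1..n} (\<lambda>i. distr M borel (X i)) = L n"
      unfolding L_def by (intro PiM_cong refl distr_X) simp
    also have "distr M (PiM {1..n} (\<lambda>_. borel)) (\<phi> n) = distr M (L n) (\<phi> n)"
      unfolding L_def by (intro distr_cong sets_PiM_cong refl sets_P[symmetric])
    finally show ?thesis .
  qed
  define a where "a n = real (m n) / real n" for n
  define W where "W n x = J n x - (\<theta> (m n) + hoeffding_term n (K n) 1 x)" for n x
  \<comment> \<open>The first summand is the bound for \<open>m n \<le> n\<close>, the second one that for \<open>m n > n\<close>.\<close>
  let ?C = "4 * c\<^sub>1\<^sup>2 + B\<^sup>2"
  have W: "W n \<in> borel_measurable (L n)" for n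
  proof -
    interpret fam: product_prob_space "\<lambda>_::nat. P" "{1..n}" using ps by (intro product_prob_spaceI)
    have "integrable (PiM {i} (\<lambda>_. P)) (K n {i})" if "i \<in> {1..n}" for i
      using K[of n] that by (simp add: hoeffding_decomposition_def)
    then have "(\<lambda>x. K n {i} (restrict x {i})) \<in> borel_measurable (L n)" if "i \<in> {1..n}" for i
      unfolding L_def using that
      by (intro borel_measurable_integrable fam.integrable_restrict_PiM) auto
    then show ?thesis
      unfolding W_def[abs_def] hoeffding_term_1
      by (intro borel_measurable_diff borel_measurable_add borel_measurable_sum
          bounded_measurable_measurable[OF J]) auto
  qed
  have moment: "integrable (L n) (\<lambda>x. (W n x / a n)\<^sup>2) \<and> (\<integral>x. (W n x / a n)\<^sup>2 \<partial>L n) \<le> ?C"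
    if "a n \<noteq> 0" for n
  proof -
    interpret L: prob_space "L n" by (rule prob_L)
    have n: "1 \<le> n" "1 \<le> m n" using that by (auto simp: a_def Suc_le_eq)
    \<comment> \<open>The recentring term is zero when \<open>m n \<le> n\<close>; otherwise it is all that is left of \<open>W n\<close>.\<close>
    define V where "V x = nonlinear_part (\<lambda>_. P) {1..n} (J n) x + ((\<integral>z. J n z \<partial>L n) - \<theta> (m n))" for x
    have WV: "AE x in L n. W n x = V x"
      using nonlinear_part_hoeffding[OF ps J[unfolded L_def] K] unfolding L_def
      by eventually_elim (simp add: W_def V_def L_def)
    have V: "bounded_measurable (L n) V"
    proof -
      interpret fam: product_prob_space "\<lambda>_::nat. P" "{1..n}" using ps by (intro product_prob_spaceI)
      show ?thesis
        unfolding V_def[abs_def] L_def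
        by (intro bm_intros fam.bounded_measurable_nonlinear_part J[unfolded L_def])
    qed
    have V2: "integrable (L n) (\<lambda>x. (V x)\<^sup>2)"
      by (intro L.bounded_measurable_integrable bm_intros V)
    have eq: "AE x in L n. (V x)\<^sup>2 / (a n)\<^sup>2 = (W n x / a n)\<^sup>2"
      using WV by eventually_elim (simp add: power_divide)
    have meas: "(\<lambda>x. (V x)\<^sup>2 / (a n)\<^sup>2) \<in> borel_measurable (L n)"
      "(\<lambda>x. (W n x / a n)\<^sup>2) \<in> borel_measurable (L n)"
      using bounded_measurable_measurable[OF V] W[of n] by measurable
    have "integrable (L n) (\<lambda>x. (V x)\<^sup>2 / (a n)\<^sup>2)" using V2 by simp
    then have int: "integrable (L n) (\<lambda>x. (W n x / a n)\<^sup>2)"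
      using integrable_cong_AE[OF meas eq] by simp
    have "(\<integral>x. (W n x / a n)\<^sup>2 \<partial>L n) = (\<integral>x. (V x)\<^sup>2 / (a n)\<^sup>2 \<partial>L n)"
      by (rule integral_cong_AE[OF meas eq, symmetric])
    also have "\<dots> = (\<integral>x. (V x)\<^sup>2 \<partial>L n) / (a n)\<^sup>2"
      by simp
    also have "\<dots> \<le> ?C"
    proof (cases "m n \<le> n")
      case True
      then have "(\<integral>z. J n z \<partial>L n) = \<theta> (m n)"
        unfolding J_def L_def \<theta>_def by (intro integral_subsample_mean ps g[unfolded L_def])
      then have "(\<integral>x. (V x)\<^sup>2 \<partial>L n) \<le> (2 * c\<^sub>1 * a n)\<^sup>2"
        unfolding V_def a_def using integral_nonlinear_part_subsample_mean_square_le[OF ps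
            g[unfolded L_def] n(2) True diff2_le] by (simp add: J_def L_def)
      then have "(\<integral>x. (V x)\<^sup>2 \<partial>L n) / (a n)\<^sup>2 \<le> (2 * c\<^sub>1 * a n)\<^sup>2 / (a n)\<^sup>2"
        by (rule divide_right_mono) simp
      also have "\<dots> = 4 * c\<^sub>1\<^sup>2"
        using that by (simp add: power_mult_distrib)
      finally show ?thesis by (rule order_trans) simp
    next
      case False
      \<comment> \<open>No subsample of size \<open>m n\<close> exists, and the empty mean is zero by convention.\<close>
      then have "J n = (\<lambda>_. 0)"
        by (simp add: J_def subsample_mean_def fun_eq_iff)
      then have "V = (\<lambda>_. - \<theta> (m n))"
        by (simp add: V_def fun_eq_iff nonlinear_part_def conditional_mean_def)
      then have "(\<integral>x. (V x)\<^sup>2 \<partial>L n) / (a n)\<^sup>2 = (\<theta> (m n))\<^sup>2 / (a n)\<^sup>2"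
        by (simp add: L.prob_space)
      also have "\<dots> \<le> B\<^sup>2 / 1"
      proof (rule frac_le)
        show "(\<theta> (m n))\<^sup>2 \<le> B\<^sup>2"
          using power_mono[OF \<theta>_bound[of "m n"], of 2] by simp
        show "1 \<le> (a n)\<^sup>2"
          using False n by (intro one_le_power) (simp add: a_def le_divide_eq)
      qed simp_all
      finally show ?thesis by (rule order_trans) simp
    qed
    finally show ?thesis using int by blast
  qed
  have Z: "(\<lambda>\<omega>. W n (\<phi> n \<omega>) / a n) \<in> borel_measurable M \<and>
      integrable M (\<lambda>\<omega>. (W n (\<phi> n \<omega>) / a n)\<^sup>2) \<and> (\<integral>\<omega>. (W n (\<phi> n \<omega>) / a n)\<^sup>2 \<partial>M) \<le> ?C" for n
  proof (cases "a n = 0")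
    \<comment> \<open>Division by \<open>a n = 0\<close> gives zero; this covers \<open>n = 0\<close> and \<open>m n = 0\<close>.\<close>
    case True
    then show ?thesis by simp
  next
    case False
    then have "n \<ge> 1" by (auto simp: a_def Suc_le_eq)
    note distr = distr_\<phi>[OF this]
    have meas: "(\<lambda>x. (W n x / a n)\<^sup>2) \<in> borel_measurable (L n)"
      using W[of n] by measurable
    have "(\<lambda>\<omega>. W n (\<phi> n \<omega>) / a n) \<in> borel_measurable M"
      using measurable_compose[OF \<phi> W] by measurable
    moreover have "integrable M (\<lambda>\<omega>. (W n (\<phi> n \<omega>) / a n)\<^sup>2)"
      using integrable_distr[OF \<phi>[of n], of "\<lambda>x. (W n x / a n)\<^sup>2"] moment[OF False]
      unfolding distr by simp
    moreover have "(\<integral>\<omega>. (W n (\<phi> n \<omega>) / a n)\<^sup>2 \<partial>M) = (\<integral>x. (W n x / a n)\<^sup>2 \<partial>L n)"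
      using integral_distr[OF \<phi>[of n] meas] unfolding distr by simp
    ultimately show ?thesis using moment[OF False] by simp
  qed
  have "tight (\<lambda>n. distr M borel (\<lambda>\<omega>. W n (\<phi> n \<omega>) / a n))"
    using Z by (intro tight_if_bounded_second_moments[of M _ ?C] M.prob_space_axioms) auto
  then show ?thesis
    by (simp add: bigo_P_def Let_def W_def \<phi>_def a_def)
qed

end
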